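(* In the secretary problem with values in $[0,1]$, the best-only pricing curve with threshold function $f(t)=\exp(-t/c)$, $c=0.611$, has worst-case regret at most $0.23$.
   Context: Secretary problem: an adversary fixes $n$ values $1\ge x_1\ge\dots\ge x_n\ge 0$; each $x_i$ arrives at an independent uniform time $t_i\in[0,1]$; an online algorithm observes values in increasing arrival time, irrevocably decides whether to pick each, picks at most one, and obtains $0$ if it picks none. The regret is $\sup_{\vec x}(x_1-\mathbb{E}[\mathsf{Alg}(\vec x)])$ over all $n$ and all value vectors. A best-only pricing curve with threshold function $f:[0,1]\to[0,1]$ picks the first arriving value $x_i$ such that both $x_i\ge f(t_i)$ and $x_i$ is the largest value arrived so far (ties are broken by adding arbitrarily small noise so that values are distinct). *)

theory Defs
  imports "HOL-Probability.Probability"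
begin

text \<open>
  An instance is a number \<open>n\<close> together with values \<open>x 1 \<ge> \<dots> \<ge> x n\<close> in the unit interval;
  the function \<open>x\<close> is only ever inspected on the indices \<open>1, \<dots>, n\<close>.
\<close>

definition secretary_instances :: "(nat \<times> (nat \<Rightarrow> real)) set" where
  "secretary_instances =
     {(n, x). 1 \<le> n \<and> antimono_on {1..n} x \<and> (\<forall>i\<in>{1..n}. 0 \<le> x i \<and> x i \<le> 1)}"

definition arrival_times :: "nat \<Rightarrow> (nat \<Rightarrow> real) measure" where
  "arrival_times n = PiM {1..n} (\<lambda>_. uniform_measure lborel {0..1})"

text \<open>
  An algorithm is represented by its payoff \<open>A n x t\<close>: the value obtained on the instance
  \<open>(n, x)\<close> when item \<open>i\<close> arrives at time \<open>t i\<close>. The supremum is taken in the extended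
  reals, where it always exists.
\<close>

definition regret :: "(nat \<Rightarrow> (nat \<Rightarrow> real) \<Rightarrow> (nat \<Rightarrow> real) \<Rightarrow> real) \<Rightarrow> ereal" where
  "regret A = (SUP (n, x)\<in>secretary_instances.
     ereal (x 1 - (\<integral>t. A n x t \<partial>arrival_times n)))"

text \<open>
  Equal values are made distinct by an infinitesimal perturbation that is attached to the items
  before they arrive: among equal values, the one with the smaller index counts as larger. In
  particular, an item that merely repeats the current maximum need not be a new maximum. Since
  arrival times are exchangeable, which order is used among equal values does not affect the
  law of the payoff.
\<close>

definition outranks :: "(nat \<Rightarrow> real) \<Rightarrow> nat \<Rightarrow> nat \<Rightarrow> bool" where
  "outranks x i j \<longleftrightarrow> x j < x i \<or> (x j = x i \<and> i < j)"

definition best_so_far :: "nat \<Rightarrow> (nat \<Rightarrow> real) \<Rightarrow> (nat \<Rightarrow> real) \<Rightarrow> nat \<Rightarrow> bool" where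
  "best_so_far n x t i \<longleftrightarrow> (\<forall>j\<in>{1..n}. t j < t i \<longrightarrow> outranks x i j)"

definition acceptable ::
  "(real \<Rightarrow> real) \<Rightarrow> nat \<Rightarrow> (nat \<Rightarrow> real) \<Rightarrow> (nat \<Rightarrow> real) \<Rightarrow> nat \<Rightarrow> bool" where
  "acceptable f n x t i \<longleftrightarrow> i \<in> {1..n} \<and> f (t i) \<le> x i \<and> best_so_far n x t i"

text \<open>
  The picked item is the first acceptable one. The strict inequality makes it unique; it only
  matters on the null event that two items arrive simultaneously.
\<close>

definition picked ::
  "(real \<Rightarrow> real) \<Rightarrow> nat \<Rightarrow> (nat \<Rightarrow> real) \<Rightarrow> (nat \<Rightarrow> real) \<Rightarrow> nat \<Rightarrow> bool" where
  "picked f n x t i \<longleftrightarrow> acceptable f n x t i \<and>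
     (\<forall>j. acceptable f n x t j \<and> j \<noteq> i \<longrightarrow> t i < t j)"

definition best_only_pricing ::
  "(real \<Rightarrow> real) \<Rightarrow> nat \<Rightarrow> (nat \<Rightarrow> real) \<Rightarrow> (nat \<Rightarrow> real) \<Rightarrow> real" where
  "best_only_pricing f n x t =
     (if \<exists>i. picked f n x t i then x (THE i. picked f n x t i) else 0)"

end

theory Submission
  imports Defs "HOL-Real_Asymp.Real_Asymp"
begin

text \<open>
  Let \<open>a \<le> b\<close> be the times at which the thresholds reach the two largest values. If nothing is
  picked, the best item arrived before \<open>a\<close>. If item \<open>i \<ge> 2\<close> is picked, then among the items
  \<open>2, 3, \<dots>\<close> preceding the best one, the best of them arrives no earlier than item \<open>i\<close>, hence not
  before \<open>b\<close>; if \<open>i \<ge> 3\<close>, the same holds for the best item of \<open>3, 4, \<dots>\<close> preceding the two best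
  ones, and its arrival time bounds the picked value from below by the threshold. The arrival
  times of these two record items have sub-densities \<open>- ln y\<close> and \<open>2 (y - 1 - ln y)\<close>, whatever
  \<open>n\<close> is. This bounds the regret by a function of \<open>a\<close> and \<open>b\<close> only. For large \<open>b\<close> the variable \<open>a\<close>
  is eliminated by \<open>z exp (- z / c) \<le> c / e\<close>, and a polynomial inequality in \<open>1 - b\<close> remains; for
  small \<open>b\<close> the bound essentially decreases in \<open>b\<close>.
\<close>

section \<open>Integrals over independent uniform arrival times\<close>

abbreviation unif :: "real measure" where
  "unif \<equiv> uniform_measure lborel {0..1}"

lemma prob_space_unif: "prob_space unif"
  by (rule prob_space_uniform_measure) auto

lemma AE_unif: "AE t in unif. t \<in> {0..1}"
  by (rule AE_uniform_measureI) auto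

lemma product_unif: "product_prob_space (\<lambda>_. unif)"
  by (simp add: product_prob_space_def product_prob_space_axioms_def product_sigma_finite_def
      prob_space_unif prob_space_imp_sigma_finite)

lemma emeasure_unif_atLeast: "s \<in> {0..1} \<Longrightarrow> emeasure unif {s..} = ennreal (1 - s)"
proof -
  assume s: "s \<in> {0..1}"
  then have "{0..1} \<inter> {s..} = {s..1}"
    by auto
  then show ?thesis
    using s by (simp add: divide_ennreal_def)
qed

lemma nn_integral_unif:
  assumes "f \<in> borel_measurable borel"
  shows "(\<integral>\<^sup>+t. f t \<partial>unif) = (\<integral>\<^sup>+t. f t * indicator {0..1} t \<partial>lborel)"
  using assms by (subst nn_integral_uniform_measure) (auto simp: divide_ennreal_def)

text \<open>Fubini isolates the coordinates \<open>m\<close> and \<open>k\<close>; once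
  \<open>t k = s\<close> is fixed, the items of \<open>S\<close> are independent and each arrives no
  earlier than \<open>s\<close> with probability \<open>1 - s\<close>. The kernel \<open>h\<close>
  is arbitrary so that one formula gives both the record densities and, with \<open>S\<close> empty,
  the almost sure distinctness of arrival times.\<close>

lemma nn_integral_two_arrivals:
  fixes h :: "real \<Rightarrow> real \<Rightarrow> ennreal"
  assumes I: "finite I" "m \<in> I" "k \<in> I" "m \<noteq> k" and S: "S \<subseteq> I - {m, k}"
    and h[measurable]: "(\<lambda>(y, s). h y s) \<in> borel_measurable (borel \<Otimes>\<^sub>M borel)"
  shows "(\<integral>\<^sup>+t. h (t m) (t k) * (\<Prod>j\<in>S. indicator {t k..} (t j)) \<partial>PiM I (\<lambda>_. unif)) =
    (\<integral>\<^sup>+y. \<integral>\<^sup>+s. h y s * ennreal (1 - s) ^ card S \<partial>unif \<partial>unif)"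
proof -
  interpret product_prob_space "\<lambda>_. unif" by (rule product_unif)
  define J where "J = I - {m, k}"
  have J: "finite J" "m \<notin> insert k J" "k \<notin> J" "insert m (insert k J) = I" "S \<subseteq> J"
    using I S by (auto simp: J_def)
  have fS: "finite S"
    using J finite_subset by blast
  have [measurable_cong]: "sets unif = sets borel" by simp
  have rest: "(\<integral>\<^sup>+t. (\<Prod>j\<in>S. indicator {s..} (t j)) \<partial>PiM J (\<lambda>_. unif)) = ennreal (1 - s) ^ card S"
    if "s \<in> {0..1}" for s :: real
  proof -
    \<comment> \<open>Items of \<open>J\<close> outside \<open>S\<close> get the factor 1, so that
      the product formula over all of \<open>J\<close> applies.\<close>
    have "(\<integral>\<^sup>+t. (\<Prod>j\<in>S. indicator {s..} (t j)) \<partial>PiM J (\<lambda>_. unif))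
      = (\<integral>\<^sup>+t. (\<Prod>j\<in>J. (if j \<in> S then indicator {s..} (t j) else 1)) \<partial>PiM J (\<lambda>_. unif))"
      using J by (intro nn_integral_cong, subst prod.inter_restrict[symmetric])
        (auto simp: Int_absorb1 )
    also have "\<dots> = (\<Prod>j\<in>J. \<integral>\<^sup>+y. (if j \<in> S then indicator {s..} y else 1) \<partial>unif)"
      using J by (intro product_nn_integral_prod) auto
    also have "\<dots> = (\<Prod>j\<in>J. if j \<in> S then ennreal (1 - s) else 1)"
      using that prob_space.emeasure_space_1[OF prob_space_unif]
      by (intro prod.cong) (auto simp: emeasure_unif_atLeast simp del: emeasure_uniform_measure)
    also have "\<dots> = (\<Prod>j\<in>S. ennreal (1 - s))"
      using J by (subst prod.inter_restrict[symmetric]) (auto simp: Int_absorb1)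
    finally show ?thesis by simp
  qed
  have meas_le: "(\<lambda>t. of_bool (t k \<le> t j) :: ennreal) \<in> borel_measurable (PiM K (\<lambda>_. unif))"
    if "k \<in> K" "j \<in> K" for k j :: 'a and K
    using that unfolding of_bool_def by measurable
  have m1: "(\<lambda>t. h (t m) (t k) * (\<Prod>j\<in>S. indicator {t k..} (t j))) \<in>
      borel_measurable (PiM (insert m (insert k J)) (\<lambda>_. unif))"
  proof (intro borel_measurable_times_ennreal borel_measurable_prod_ennreal)
    have "(\<lambda>t. (t m, t k)) \<in> PiM (insert m (insert k J)) (\<lambda>_. unif) \<rightarrow>\<^sub>M borel \<Otimes>\<^sub>M borel"
      by measurable
    from measurable_compose[OF this h]
    show "(\<lambda>t. h (t m) (t k)) \<in> borel_measurable (PiM (insert m (insert k J)) (\<lambda>_. unif))"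
      by simp
    show "(\<lambda>t. indicator {t k..} (t j) :: ennreal) \<in> borel_measurable (PiM (insert m (insert k J)) (\<lambda>_. unif))"
      if "j \<in> S" for j
      using subsetD[OF J(5) that] meas_le[of k "insert m (insert k J)" j] by (auto simp: indicator_def)
  qed
  have m2: "(\<lambda>t. h y (t k) * (\<Prod>j\<in>S. indicator {t k..} (t j))) \<in>
      borel_measurable (PiM (insert k J) (\<lambda>_. unif))" for y
  proof (intro borel_measurable_times_ennreal borel_measurable_prod_ennreal)
    have "(\<lambda>t. (y, t k)) \<in> PiM (insert k J) (\<lambda>_. unif) \<rightarrow>\<^sub>M borel \<Otimes>\<^sub>M borel"
      by measurable
    from measurable_compose[OF this h]
    show "(\<lambda>t. h y (t k)) \<in> borel_measurable (PiM (insert k J) (\<lambda>_. unif))"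
      by simp
    show "(\<lambda>t. indicator {t k..} (t j) :: ennreal) \<in> borel_measurable (PiM (insert k J) (\<lambda>_. unif))"
      if "j \<in> S" for j
      using subsetD[OF J(5) that] meas_le[of k "insert k J" j] by (auto simp: indicator_def)
  qed
  have "(\<integral>\<^sup>+t. h (t m) (t k) * (\<Prod>j\<in>S. indicator {t k..} (t j)) \<partial>PiM I (\<lambda>_. unif))
    = (\<integral>\<^sup>+y. \<integral>\<^sup>+t. h y (t k) * (\<Prod>j\<in>S. indicator {t k..} (t j)) \<partial>PiM (insert k J) (\<lambda>_. unif) \<partial>unif)"
    unfolding J(4)[symmetric] using J m1
    by (subst product_nn_integral_insert_rev)
      (auto intro!: nn_integral_cong arg_cong2[where f="(*)"] prod.cong)
  also have "\<dots> = (\<integral>\<^sup>+y. \<integral>\<^sup>+s. \<integral>\<^sup>+t. h y s * (\<Prod>j\<in>S. indicator {s..} (t j)) \<partial>PiM J (\<lambda>_. unif) \<partial>unif \<partial>unif)"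
    using J m2
    by (subst product_nn_integral_insert_rev)
      (auto intro!: nn_integral_cong arg_cong2[where f="(*)"] prod.cong)
  also have "\<dots> = (\<integral>\<^sup>+y. \<integral>\<^sup>+s. h y s * (\<integral>\<^sup>+t. (\<Prod>j\<in>S. indicator {s..} (t j)) \<partial>PiM J (\<lambda>_. unif)) \<partial>unif \<partial>unif)"
  proof (intro nn_integral_cong nn_integral_cmult)
    show "(\<lambda>t. \<Prod>j\<in>S. indicator {s..} (t j) :: ennreal) \<in> borel_measurable (PiM J (\<lambda>_. unif))" for s :: real
    proof (rule borel_measurable_prod_ennreal)
      show "(\<lambda>t. indicator {s..} (t j) :: ennreal) \<in> borel_measurable (PiM J (\<lambda>_. unif))" if "j \<in> S" for j
        using subsetD[OF J(5) that] by measurable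
    qed
  qed
  also have "\<dots> = (\<integral>\<^sup>+y. \<integral>\<^sup>+s. h y s * ennreal (1 - s) ^ card S \<partial>unif \<partial>unif)"
    by (intro nn_integral_cong nn_integral_cong_AE, rule eventually_mono[OF AE_unif]) (simp only: rest)
  finally show ?thesis .
qed

lemma nn_integral_unif_power:
  assumes y: "y \<in> {0..1}"
  shows "(\<integral>\<^sup>+s. indicator {y<..} s * ennreal (1 - s) ^ N \<partial>unif) = ennreal ((1 - y) ^ Suc N / Suc N)"
proof -
  have "(\<integral>\<^sup>+s. indicator {y<..} s * ennreal (1 - s) ^ N \<partial>unif) =
    (\<integral>\<^sup>+s. indicator {y<..} s * ennreal (1 - s) ^ N * indicator {0..1} s \<partial>lborel)"
    by (rule nn_integral_unif) measurable
  also have "\<dots> = (\<integral>\<^sup>+s. ennreal ((1 - s) ^ N) * indicator {y..1} s \<partial>lborel)"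
  proof (rule nn_integral_cong_AE)
    have "AE s in lborel. s \<noteq> y"
      by (rule AE_lborel_singleton)
    then show "AE s in lborel. indicator {y<..} s * ennreal (1 - s) ^ N * indicator {0..1} s =
      ennreal ((1 - s) ^ N) * indicator {y..1} s"
      by eventually_elim (use y in \<open>auto simp: indicator_def ennreal_power\<close>)
  qed
  also have "\<dots> = ennreal (- ((1 - 1) ^ Suc N / Suc N) - (- ((1 - y) ^ Suc N / Suc N)))"
  proof (rule nn_integral_FTC_Icc)
    show "((\<lambda>s. - ((1 - s) ^ Suc N / Suc N)) has_real_derivative (1 - s) ^ N) (at s)" for s
    proof -
      have "((\<lambda>s::real. 1 - s) has_real_derivative -1) (at s)"
        by (auto intro!: derivative_eq_intros)
      from DERIV_minus[OF DERIV_cdivide[OF DERIV_power_Suc[OF this, of N], of "real (Suc N)"]]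
      show ?thesis
        by (simp add: add.commute)
    qed
  qed (use y in auto)
  finally show ?thesis by simp
qed

text \<open>The integrand lives where \<open>m\<close> precedes \<open>k\<close> and nothing in
  \<open>S\<close> does: if \<open>S\<close> lists the better competitors, \<open>m\<close> is the
  record before \<open>k\<close>. Integrating \<open>(1 - s) ^ card S\<close> over
  \<open>s > y\<close> gives the weight at \<open>t m = y\<close>.\<close>

lemma nn_integral_arrival_before:
  fixes g :: "real \<Rightarrow> ennreal"
  assumes I: "finite I" "m \<in> I" "k \<in> I" "m \<noteq> k" and S: "S \<subseteq> I - {m, k}"
    and g[measurable]: "g \<in> borel_measurable borel"
  shows "(\<integral>\<^sup>+t. g (t m) * indicator {t m<..} (t k) * (\<Prod>j\<in>S. indicator {t k..} (t j)) \<partial>PiM I (\<lambda>_. unif)) =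
    (\<integral>\<^sup>+y. g y * ennreal ((1 - y) ^ Suc (card S) / Suc (card S)) \<partial>unif)"
proof -
  have "(\<lambda>(y, s). g y * indicator {y<..} s) \<in> borel_measurable (borel \<Otimes>\<^sub>M borel)"
    unfolding indicator_def greaterThan_iff by measurable
  from nn_integral_two_arrivals[OF I S this]
  have "(\<integral>\<^sup>+t. g (t m) * indicator {t m<..} (t k) * (\<Prod>j\<in>S. indicator {t k..} (t j)) \<partial>PiM I (\<lambda>_. unif)) =
    (\<integral>\<^sup>+y. \<integral>\<^sup>+s. g y * (indicator {y<..} s * ennreal (1 - s) ^ card S) \<partial>unif \<partial>unif)"
    by (simp add: mult.assoc)
  also have "\<dots> = (\<integral>\<^sup>+y. g y * (\<integral>\<^sup>+s. indicator {y<..} s * ennreal (1 - s) ^ card S \<partial>unif) \<partial>unif)"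
    by (intro nn_integral_cong nn_integral_cmult) measurable
  also have "\<dots> = (\<integral>\<^sup>+y. g y * ennreal ((1 - y) ^ Suc (card S) / Suc (card S)) \<partial>unif)"
    by (intro nn_integral_cong_AE, rule eventually_mono[OF AE_unif]) (simp only: nn_integral_unif_power)
  finally show ?thesis .
qed

text \<open>These are partial sums of the Mercator series, whose terms are nonnegative. Index 0 may
  belong to \<open>A\<close>: its term is a division by zero, hence 0.\<close>

lemma sum_power_divide_le_minus_ln:
  fixes d :: real
  assumes "0 \<le> d" "d < 1" "finite A"
  shows "(\<Sum>i\<in>A. d ^ i / i) \<le> - ln (1 - d)"
proof -
  have *: "(\<lambda>i. - ((- (- d)) ^ i) / real i) sums ln (1 + (- d))"
    using assms by (intro ln_series') auto
  have sums: "(\<lambda>i. d ^ i / real i) sums (- ln (1 - d))"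
    using sums_minus[OF *] by simp
  then show ?thesis
    using assms sum_le_suminf[OF sums_summable[OF sums], of A] by (simp add: sums_iff)
qed

lemma AE_distinct_arrivals:
  assumes I: "finite I" "m \<in> I" "k \<in> I" "m \<noteq> k"
  shows "AE t in PiM I (\<lambda>_. unif). t m \<noteq> t k"
proof -
  have h: "(\<lambda>(y, s). if y = s then 1 else 0 :: ennreal) \<in> borel_measurable (borel \<Otimes>\<^sub>M (borel :: real measure))"
    by measurable
  have [measurable_cong]: "sets unif = sets borel" by simp
  have "(\<integral>\<^sup>+t. (if t m = t k then 1 else 0) \<partial>PiM I (\<lambda>_. unif)) =
    (\<integral>\<^sup>+y. \<integral>\<^sup>+s. (if y = s then 1 else 0) \<partial>unif \<partial>unif)"
    using nn_integral_two_arrivals[OF I empty_subsetI h] by simp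
  also have "\<dots> = 0"
  proof -
    have "AE s in unif. (if y = s then 1 else 0 :: ennreal) = 0" for y
    proof (rule AE_uniform_measureI)
      have "AE s in lborel. s \<noteq> y" by (rule AE_lborel_singleton)
      then show "AE s in lborel. s \<in> {0..1} \<longrightarrow> (if y = s then 1 else 0 :: ennreal) = 0"
        by eventually_elim auto
    qed simp
    then have "(\<integral>\<^sup>+s. (if y = s then 1 else 0) \<partial>unif) = 0" for y
      by (subst nn_integral_0_iff_AE) auto
    then show ?thesis by simp
  qed
  finally have "(\<integral>\<^sup>+t. (if t m = t k then 1 else 0) \<partial>PiM I (\<lambda>_. unif)) = 0" .
  moreover have "(\<lambda>t. if t m = t k then 1 else 0 :: ennreal) \<in> borel_measurable (PiM I (\<lambda>_. unif))"
    using I by measurable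
  ultimately have "AE t in PiM I (\<lambda>_. unif). (if t m = t k then 1 else 0 :: ennreal) = 0"
    by (subst (asm) nn_integral_0_iff_AE) auto
  then show ?thesis by eventually_elim (auto split: if_splits)
qed

section \<open>Combinatorics of the picked item and the pathwise loss\<close>

lemma picked_unique:
  assumes "picked f n x t i" "picked f n x t j"
  shows "j = i"
proof (rule ccontr)
  assume "j \<noteq> i"
  then have "t i < t j" "t j < t i"
    using assms by (auto simp: picked_def)
  then show False by simp
qed

lemma best_only_pricing_eq:
  assumes "picked f n x t i"
  shows "best_only_pricing f n x t = x i"
proof -
  have "(THE i. picked f n x t i) = i"
    using the_equality[of "picked f n x t", OF assms picked_unique[OF assms]] .
  then show ?thesis
    using assms unfolding best_only_pricing_def by metis
qed

text \<open>The earliest acceptable item is picked; injectivity of \<open>t\<close> upgrades its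
  minimality to the strict inequality that \<open>picked\<close> demands.\<close>

lemma ex_picked:
  assumes "acceptable f n x t k" "inj_on t {1..n}"
  shows "\<exists>i. picked f n x t i"
proof -
  define i where "i = arg_min_on t {j. acceptable f n x t j}"
  have fin: "finite {j. acceptable f n x t j}"
    by (rule finite_subset[of _ "{1..n}"]) (auto simp: acceptable_def)
  then have i: "acceptable f n x t i" and le: "acceptable f n x t j \<Longrightarrow> t i \<le> t j" for j
    using assms arg_min_if_finite(1)[OF fin, of t] arg_min_least[OF fin, of j t]
    by (auto simp: i_def)
  have "t i < t j" if j: "acceptable f n x t j" "j \<noteq> i" for j
  proof -
    have "t i \<noteq> t j"
      using inj_onD[OF assms(2), of i j] i j by (auto simp: acceptable_def)
    then show ?thesis
      using le[OF j(1)] by simp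
  qed
  then show ?thesis
    using i by (auto simp: picked_def)
qed

text \<open>On sorted values, tie-breaking by index makes rank and index coincide, so the later
  arguments only compare indices.\<close>

lemma outranks_iff:
  assumes "antimono_on {1..n} x" "i \<in> {1..n}" "j \<in> {1..n}"
  shows "outranks x i j \<longleftrightarrow> i < j"
proof -
  have mono: "x l \<le> x k" if "k \<in> {1..n}" "l \<in> {1..n}" "k \<le> l" for k l
    using assms(1) that by (auto simp: monotone_on_def)
  show ?thesis
    using mono[OF assms(2,3)] mono[OF assms(3,2)] by (cases "i < j") (auto simp: outranks_def)
qed

text \<open>Take for \<open>m\<close> the smallest index from \<open>r\<close> on that arrives
  before \<open>s\<close>. Item \<open>i\<close> is itself a candidate, so \<open>m \<le> i\<close>;
  had \<open>m\<close> arrived before \<open>i\<close>, the best-so-far property of \<open>i\<close>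
  would force \<open>i < m\<close>.\<close>

lemma first_arrival_before:
  assumes "antimono_on {1..n} x" "best_so_far n x t i" "i \<in> {1..n}" "t i < s" "1 \<le> r" "r \<le> i"
  obtains m where "m \<in> {r..n}" "t i \<le> t m" "t m < s" "\<And>j. j \<in> {r..<m} \<Longrightarrow> s \<le> t j"
proof -
  define m where "m = (LEAST m. r \<le> m \<and> t m < s)"
  have m: "r \<le> m" "t m < s" "m \<le> i" "\<And>j. r \<le> j \<Longrightarrow> t j < s \<Longrightarrow> m \<le> j"
    using LeastI[of "\<lambda>m. r \<le> m \<and> t m < s" i] Least_le[of "\<lambda>m. r \<le> m \<and> t m < s"] assms
    by (auto simp: m_def)
  have "m \<in> {1..n}" "m \<in> {r..n}"
    using assms m by auto
  moreover have "t i \<le> t m"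
  proof (rule ccontr)
    assume "\<not> t i \<le> t m"
    then have "outranks x i m"
      using assms(2) \<open>m \<in> {1..n}\<close> by (simp add: best_so_far_def)
    then show False
      using m(3) outranks_iff[OF assms(1,3) \<open>m \<in> {1..n}\<close>] by simp
  qed
  moreover have "s \<le> t j" if "j \<in> {r..<m}" for j
    using m(4)[of j] that by force
  ultimately show ?thesis
    using m by (intro that[of m])
qed


text \<open>The first term pays for picking nothing. If an item \<open>i \<ge> 2\<close> is picked,
  its loss splits at the second largest value \<open>v\<close>: \<open>x 1 - v\<close> is charged to
  the record among 2, 3, ... before item 1, and \<open>v - x i\<close> to the record among 3, 4, ...
  before both top items. The last two sums distinguish which of the top items arrives first; summing
  over \<open>m\<close> replaces the random index of the record.\<close>

lemma best_only_pricing_loss_le: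
  fixes x t :: "nat \<Rightarrow> real"
  assumes n: "1 \<le> n" and x: "antimono_on {1..n} x" and inj: "inj_on t {1..n}"
    and t: "\<And>i. i \<in> {1..n} \<Longrightarrow> t i \<in> {0..1}" and f: "antimono_on {0..1} f"
    and v: "v \<le> x 1" "2 \<le> n \<Longrightarrow> v = x 2"
  shows "ennreal (x 1 - best_only_pricing f n x t) \<le> ennreal (x 1) * indicator {y. x 1 < f y} (t 1)
    + (\<Sum>m=2..n. (ennreal (x 1 - v) * indicator {y. f y \<le> v} (t m)) * indicator {t m<..} (t 1) *
        (\<Prod>j\<in>{2..<m}. indicator {t 1..} (t j)))
    + (\<Sum>m=3..n. ennreal (v - f (t m)) * indicator {t m<..} (t 1) *
        (\<Prod>j\<in>{2..<m}. indicator {t 1..} (t j)))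
    + (\<Sum>m=3..n. ennreal (v - f (t m)) * indicator {t m<..} (t 2) *
        (\<Prod>j\<in>insert 1 {3..<m}. indicator {t 2..} (t j)))"
    (is "_ \<le> ?A + (\<Sum>m=2..n. ?B m) + (\<Sum>m=3..n. ?C m) + (\<Sum>m=3..n. ?D m)")
proof (cases "\<exists>i. picked f n x t i")
  case False
  \<comment> \<open>Item 1 is always best so far, so it can only fail to be acceptable by missing
    the threshold.\<close>
  have best1: "outranks x 1 j" if "j \<in> {1..n}" "t j < t 1" for j
    using outranks_iff[OF x, of 1 j] that n by (cases "j = 1") auto
  have "x 1 < f (t 1)"
  proof (rule ccontr)
    assume "\<not> x 1 < f (t 1)"
    then have "acceptable f n x t 1"
      using n best1 by (simp add: acceptable_def best_so_far_def)
    then show False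
      using ex_picked[OF _ inj] False by blast
  qed
  then have "ennreal (x 1 - best_only_pricing f n x t) \<le> ?A"
    using False by (simp add: best_only_pricing_def)
  then show ?thesis
    by (intro add_increasing2[OF zero_le])
next
  case True
  then obtain i where pick: "picked f n x t i" by blast
  then have i: "i \<in> {1..n}" and fi: "f (t i) \<le> x i" and best: "best_so_far n x t i"
    by (auto simp: picked_def acceptable_def)
  have f_mono: "f (t m) \<le> f (t i)" if "m \<in> {1..n}" "t i \<le> t m" for m
    using monotone_onD[OF f t[OF i] t[OF that(1)] that(2)] .
  have x_mono: "x k \<le> x j" if "j \<in> {1..n}" "k \<in> {1..n}" "j \<le> k" for j k
    using monotone_onD[OF x that] .
  \<comment> \<open>An earlier arrival of a better item would contradict \<open>best_so_far\<close>.
    Hence item 1, and item 2 if \<open>i \<ge> 3\<close>, arrive after \<open>i\<close>, and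
    \<open>first_arrival_before\<close> can be used with \<open>s = t 1\<close> or
    \<open>s = t 2\<close>.\<close>
  have before: "t i < t j" if "j \<in> {1..<i}" for j
  proof -
    have "j \<in> {1..n}" "\<not> outranks x i j"
      using that i outranks_iff[OF x i, of j] by auto
    then have "\<not> t j < t i"
      using best by (auto simp: best_so_far_def)
    moreover have "t i \<noteq> t j"
      using inj_onD[OF inj, of i j] i that by auto
    ultimately show ?thesis by simp
  qed
  have B: "ennreal (x 1 - v) \<le> (\<Sum>m=2..n. ?B m)" if i2: "2 \<le> i"
  proof -
    obtain m where m: "m \<in> {2..n}" "t i \<le> t m" "t m < t 1" "\<And>j. j \<in> {2..<m} \<Longrightarrow> t 1 \<le> t j"
      by (rule first_arrival_before[OF x best i before[of 1], of 2]) (use i2 in auto)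
    \<comment> \<open>The record arrives no earlier than \<open>i\<close>, so the decreasing
      threshold is at most \<open>v\<close> at time \<open>t m\<close>, and the summand of
      \<open>m\<close> equals the whole loss \<open>x 1 - v\<close>.\<close>
    have "f (t m) \<le> f (t i)"
      using m by (intro f_mono) auto
    also have "\<dots> \<le> x 2"
      using fi x_mono[of 2 i] i that by simp
    finally have "ennreal (x 1 - v) = ?B m"
      using m i that v by (simp add: prod.neutral)
    also have "\<dots> \<le> (\<Sum>m=2..n. ?B m)"
      using m by (intro member_le_sum) auto
    finally show ?thesis .
  qed
  have CD: "ennreal (v - x i) \<le> (\<Sum>m=3..n. ?C m) + (\<Sum>m=3..n. ?D m)" if "2 \<le> i"
  proof (cases "i = 2")
    case True
    then show ?thesis using v i by simp
  next
    case False
    then have i3: "3 \<le> i" using that by simp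
    \<comment> \<open>The threshold at the time of the record bounds the picked value from below:
      \<open>f (t m) \<le> f (t i) \<le> x i\<close>.\<close>
    have le: "ennreal (v - x i) \<le> ennreal (v - f (t m))" if "m \<in> {3..n}" "t i \<le> t m" for m
    proof -
      have "f (t m) \<le> f (t i)"
        using that by (intro f_mono) auto
      then show ?thesis using fi by (intro ennreal_leI) auto
    qed
    show ?thesis
    proof (cases "t 1 < t 2")
      case True
      obtain m where m: "m \<in> {3..n}" "t i \<le> t m" "t m < t 1" "\<And>j. j \<in> {3..<m} \<Longrightarrow> t 1 \<le> t j"
        by (rule first_arrival_before[OF x best i before[of 1], of 3]) (use i3 in auto)
      \<comment> \<open>The record was sought from index 3 on only; item 2 follows item 1 by the
        case assumption, so it may join the product.\<close>
      have "t 1 \<le> t j" if "j \<in> {2..<m}" for j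
        using m(4)[of j] that True by (cases "j = 2") auto
      then have "ennreal (v - x i) \<le> ?C m"
        using m le[of m] by (simp add: prod.neutral)
      also have "\<dots> \<le> (\<Sum>m=3..n. ?C m)"
        using m by (intro member_le_sum) auto
      finally show ?thesis by (rule add_increasing2[OF zero_le])
    next
      case False
      obtain m where m: "m \<in> {3..n}" "t i \<le> t m" "t m < t 2" "\<And>j. j \<in> {3..<m} \<Longrightarrow> t 2 \<le> t j"
        by (rule first_arrival_before[OF x best i before[of 2], of 3]) (use i3 in auto)
      have "t 2 \<le> t j" if "j \<in> insert 1 {3..<m}" for j
        using m(4)[of j] that False by auto
      then have "ennreal (v - x i) \<le> ?D m"
        using m le[of m] by (simp add: prod.neutral)
      also have "\<dots> \<le> (\<Sum>m=3..n. ?D m)"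
        using m by (intro member_le_sum) auto
      finally show ?thesis by (rule add_increasing[OF zero_le])
    qed
  qed
  show ?thesis
  proof (cases "2 \<le> i")
    case True
    then have "x i \<le> v"
      using v x_mono[of 2 i] i by simp
    then have "ennreal (x 1 - best_only_pricing f n x t) = ennreal (x 1 - v) + ennreal (v - x i)"
      using v by (simp add: best_only_pricing_eq[OF pick] flip: ennreal_plus)
    also have "\<dots> \<le> (\<Sum>m=2..n. ?B m) + ((\<Sum>m=3..n. ?C m) + (\<Sum>m=3..n. ?D m))"
      by (rule add_mono[OF B[OF True] CD[OF True]])
    also have "\<dots> \<le> ?A + \<dots>"
      by (intro add_increasing[OF zero_le order.refl])
    finally show ?thesis by (simp only: add.assoc)
  next
    case False
    then have "i = 1" using i by simp
    then show ?thesis by (simp add: best_only_pricing_eq[OF pick])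
  qed
qed

section \<open>Measurability and the expected loss of an instance\<close>

lemma measurable_arrival:
  assumes "i \<in> I"
  shows "(\<lambda>t. t i) \<in> borel_measurable (PiM I (\<lambda>_. unif))"
proof -
  have [measurable_cong]: "sets unif = sets borel" by simp
  show ?thesis using assms by measurable
qed

lemma borel_measurable_best_only_pricing:
  assumes f[measurable]: "f \<in> borel_measurable borel"
  shows "best_only_pricing f n x \<in> borel_measurable (PiM {1..n} (\<lambda>_. unif))"
proof -
  note arr = measurable_arrival[of _ "{1..n}"]
  have acc: "Measurable.pred (PiM {1..n} (\<lambda>_. unif)) (\<lambda>t. acceptable f n x t i)" if i: "i \<in> {1..n}" for i
  proof -
    note arr[OF i, measurable]
    have "Measurable.pred (PiM {1..n} (\<lambda>_. unif)) (\<lambda>t. t j < t i \<longrightarrow> outranks x i j)" if j: "j \<in> {1..n}" for j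
    proof -
      note arr[OF j, measurable]
      show ?thesis by measurable
    qed
    then have "Measurable.pred (PiM {1..n} (\<lambda>_. unif)) (\<lambda>t. best_so_far n x t i)"
      unfolding best_so_far_def by (intro pred_intros_finite) auto
    then show ?thesis
      unfolding acceptable_def by measurable
  qed
  have pick: "Measurable.pred (PiM {1..n} (\<lambda>_. unif)) (\<lambda>t. picked f n x t i)" if i: "i \<in> {1..n}" for i
  proof -
    note arr[OF i, measurable]
    have eq: "picked f n x t i \<longleftrightarrow> acceptable f n x t i \<and>
        (\<forall>j\<in>{1..n}. acceptable f n x t j \<and> j \<noteq> i \<longrightarrow> t i < t j)" for t
      by (auto simp: picked_def acceptable_def)
    have "Measurable.pred (PiM {1..n} (\<lambda>_. unif)) (\<lambda>t. acceptable f n x t j \<and> j \<noteq> i \<longrightarrow> t i < t j)"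
      if j: "j \<in> {1..n}" for j
    proof -
      note arr[OF j, measurable] acc[OF j, measurable]
      show ?thesis by measurable
    qed
    then have "Measurable.pred (PiM {1..n} (\<lambda>_. unif))
      (\<lambda>t. \<forall>j\<in>{1..n}. acceptable f n x t j \<and> j \<noteq> i \<longrightarrow> t i < t j)"
      by (intro pred_intros_finite) auto
    then show ?thesis
      unfolding eq using acc[OF i] by measurable
  qed
  \<comment> \<open>A finite sum with at most one surviving summand replaces the definite
    description, which reduces measurability to that of the events
    \<open>picked f n x t i\<close>.\<close>
  have eq: "best_only_pricing f n x t = (\<Sum>i\<in>{1..n}. if picked f n x t i then x i else 0)" for t
  proof (cases "\<exists>i. picked f n x t i")
    case True
    then obtain i where i: "picked f n x t i" by blast
    then have "i \<in> {1..n}" by (simp add: picked_def acceptable_def)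
    have "picked f n x t j \<longleftrightarrow> j = i" for j
      using i picked_unique by blast
    then show ?thesis
      using best_only_pricing_eq[OF i] \<open>i \<in> {1..n}\<close> by simp
  next
    case False
    then show ?thesis by (simp add: best_only_pricing_def)
  qed
  show ?thesis
    unfolding eq
  proof (rule borel_measurable_sum)
    fix i assume "i \<in> {1..n}"
    note pick[OF this, measurable]
    show "(\<lambda>t. if picked f n x t i then x i else 0) \<in> borel_measurable (PiM {1..n} (\<lambda>_. unif))"
      by measurable
  qed
qed

lemma best_only_pricing_bounds:
  assumes "\<And>i. i \<in> {1..n} \<Longrightarrow> 0 \<le> x i \<and> x i \<le> c" "0 \<le> c"
  shows "0 \<le> best_only_pricing f n x t \<and> best_only_pricing f n x t \<le> c"
proof (cases "\<exists>i. picked f n x t i")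
  case True
  then obtain i where i: "picked f n x t i" by blast
  then have "i \<in> {1..n}" by (simp add: picked_def acceptable_def)
  then show ?thesis using assms best_only_pricing_eq[OF i] by simp
qed (simp add: best_only_pricing_def assms)

text \<open>With \<open>i = m - 1\<close> these are partial sums of the expansion of
  \<open>- ln y\<close> in powers of \<open>1 - y\<close>; starting at 3 omits the leading term
  \<open>1 - y\<close>. The bounds do not involve \<open>n\<close>.\<close>

lemma sum_record_weights_le:
  assumes "y \<in> {0<..1}"
  shows "(\<Sum>m=2..n. (1 - y) ^ Suc (m - 2) / Suc (m - 2)) \<le> - ln y"
    and "(\<Sum>m=3..n. (1 - y) ^ Suc (m - 2) / Suc (m - 2)) \<le> y - 1 - ln y"
proof -
  have *: "(\<Sum>m=r..n. (1 - y) ^ Suc (m - 2) / Suc (m - 2)) = (\<Sum>i\<in>{r-1..n-1}. (1 - y) ^ i / i)" if "2 \<le> r" for r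
    by (rule sum.reindex_bij_witness[of _ Suc "\<lambda>m. m - 1"]) (use that in \<open>auto simp: Suc_diff_Suc numeral_2_eq_2\<close>)
  show "(\<Sum>m=2..n. (1 - y) ^ Suc (m - 2) / Suc (m - 2)) \<le> - ln y"
    using *[of 2] sum_power_divide_le_minus_ln[of "1 - y" "{1..n-1}"] assms by (simp del: power_Suc of_nat_Suc)
  have "(\<Sum>i\<in>insert 1 {2..n-1}. (1 - y) ^ i / i) \<le> - ln y"
    using sum_power_divide_le_minus_ln[of "1 - y" "insert 1 {2..n-1}"] assms by simp
  then show "(\<Sum>m=3..n. (1 - y) ^ Suc (m - 2) / Suc (m - 2)) \<le> y - 1 - ln y"
    using *[of 3] by (simp del: power_Suc of_nat_Suc add: of_nat_Suc[of 0])
qed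

lemma AE_unif_pos: "AE y in unif. y \<in> {0<..1}"
proof (rule AE_uniform_measureI)
  have "AE y in lborel. y \<noteq> (0::real)" by (rule AE_lborel_singleton)
  then show "AE y in lborel. y \<in> {0..1} \<longrightarrow> y \<in> {0<..1::real}"
    by eventually_elim auto
qed simp

text \<open>The pathwise bound is integrated term by term. The two sums for the later loss get the
  same density because both index sets have \<open>m - 2\<close> elements, whence the factor
  2.\<close>

lemma instance_regret_le:
  fixes x :: "nat \<Rightarrow> real"
  assumes n: "1 \<le> n" and x: "antimono_on {1..n} x" and x0: "\<And>i. i \<in> {1..n} \<Longrightarrow> 0 \<le> x i"
    and f[measurable]: "f \<in> borel_measurable borel" and f_mono: "antimono_on {0..1} f"
    and v: "v \<le> x 1" "2 \<le> n \<Longrightarrow> v = x 2"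
  shows "ennreal (x 1 - (\<integral>t. best_only_pricing f n x t \<partial>arrival_times n)) \<le>
    (\<integral>\<^sup>+y. ennreal (x 1) * indicator {y. x 1 < f y} y \<partial>unif) +
    (\<integral>\<^sup>+y. ennreal (x 1 - v) * indicator {y. f y \<le> v} y * ennreal (- ln y) \<partial>unif) +
    (\<integral>\<^sup>+y. ennreal (v - f y) * ennreal (2 * (y - 1 - ln y)) \<partial>unif)"
proof -
  interpret product_prob_space "\<lambda>_. unif" by (rule product_unif)
  let ?M = "PiM {1..n} (\<lambda>_. unif)"
  interpret Q: prob_space ?M by (rule prob_space_PiM[OF prob_space_unif])
  note meas = borel_measurable_best_only_pricing[OF f, of n x]
  have "0 \<le> x i \<and> x i \<le> x 1" if "i \<in> {1..n}" for i
    using x0 monotone_onD[OF x, of 1 i] n that by auto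
  then have bounds: "0 \<le> best_only_pricing f n x t \<and> best_only_pricing f n x t \<le> x 1" for t
    using n by (intro best_only_pricing_bounds) auto
  have int: "integrable ?M (best_only_pricing f n x)"
    using bounds meas by (intro Q.integrable_const_bound[of _ "x 1"]) auto
  note arr = measurable_arrival[of _ "{1..n}"]
  define A where "A y = ennreal (x 1) * indicator {y. x 1 < f y} y" for y
  define B where "B y = ennreal (x 1 - v) * indicator {y. f y \<le> v} y" for y
  define C where "C y = ennreal (v - f y)" for y
  have [measurable]: "A \<in> borel_measurable borel" "B \<in> borel_measurable borel" "C \<in> borel_measurable borel"
    unfolding A_def B_def C_def by measurable
  \<comment> \<open>A common template for the record terms, so that measurability and integrals are
    computed once.\<close>
  define R where "R g k m S t = g (t m) * indicator {t m<..} (t k) * (\<Prod>j\<in>S. indicator {t k..} (t j) :: ennreal)"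
    for g :: "real \<Rightarrow> ennreal" and k m :: nat and S and t :: "nat \<Rightarrow> real"
  have R_meas: "R g k m S \<in> borel_measurable ?M"
    if g[measurable]: "g \<in> borel_measurable borel" and "k \<in> {1..n}" "m \<in> {1..n}" "S \<subseteq> {1..n}" for g k m S
  proof -
    note arr[OF that(2), measurable] arr[OF that(3), measurable]
    have S: "(\<lambda>t. \<Prod>j\<in>S. indicator {t k..} (t j) :: ennreal) \<in> borel_measurable ?M"
    proof (rule borel_measurable_prod_ennreal)
      fix j assume "j \<in> S"
      note arr[OF subsetD[OF that(4) this], measurable]
      show "(\<lambda>t. indicator {t k..} (t j) :: ennreal) \<in> borel_measurable ?M"
        unfolding indicator_def atLeast_iff of_bool_def by measurable
    qed
    have "(\<lambda>t. indicator {t m<..} (t k) :: ennreal) \<in> borel_measurable ?M"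
      unfolding indicator_def greaterThan_iff of_bool_def by measurable
    then show ?thesis
      unfolding R_def using S by measurable
  qed
  have R_int: "integral\<^sup>N ?M (R g k m S) = (\<integral>\<^sup>+y. g y * ennreal ((1 - y) ^ Suc (card S) / Suc (card S)) \<partial>unif)"
    if "g \<in> borel_measurable borel" "k \<in> {1..n}" "m \<in> {1..n}" "m \<noteq> k" "S \<subseteq> {1..n} - {m, k}" for g k m S
    unfolding R_def using that by (intro nn_integral_arrival_before) auto
  have sums: "(\<Sum>m\<in>T. \<integral>\<^sup>+y. g y * ennreal ((1 - y) ^ Suc (m - 2) / Suc (m - 2)) \<partial>unif) \<le>
      (\<integral>\<^sup>+y. g y * ennreal (w y) \<partial>unif)"
    if [measurable]: "g \<in> borel_measurable borel"
      and w: "\<And>y. y \<in> {0<..1} \<Longrightarrow> (\<Sum>m\<in>T. (1 - y) ^ Suc (m - 2) / Suc (m - 2)) \<le> w y" for g T w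
  proof -
    have "(\<Sum>m\<in>T. \<integral>\<^sup>+y. g y * ennreal ((1 - y) ^ Suc (m - 2) / Suc (m - 2)) \<partial>unif)
      = (\<integral>\<^sup>+y. (\<Sum>m\<in>T. g y * ennreal ((1 - y) ^ Suc (m - 2) / Suc (m - 2))) \<partial>unif)"
      by (rule nn_integral_sum[symmetric]) measurable
    also have "\<dots> \<le> (\<integral>\<^sup>+y. g y * ennreal (w y) \<partial>unif)"
    proof (rule nn_integral_mono_AE, rule eventually_mono[OF AE_unif_pos])
      fix y :: real assume y: "y \<in> {0<..1}"
      have "(\<Sum>m\<in>T. g y * ennreal ((1 - y) ^ Suc (m - 2) / Suc (m - 2))) =
          g y * ennreal (\<Sum>m\<in>T. (1 - y) ^ Suc (m - 2) / Suc (m - 2))"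
        using y by (subst sum_ennreal[symmetric], simp, simp only: sum_distrib_left)
      also have "\<dots> \<le> g y * ennreal (w y)"
        using w[OF y] by (intro mult_left_mono ennreal_leI) auto
      finally show "(\<Sum>m\<in>T. g y * ennreal ((1 - y) ^ Suc (m - 2) / Suc (m - 2))) \<le> g y * ennreal (w y)" .
    qed
    finally show ?thesis .
  qed
  have distinct: "AE t in ?M. inj_on t {1..n}"
  proof -
    have "AE t in ?M. \<forall>i\<in>{1..n}. \<forall>j\<in>{1..n}. i \<noteq> j \<longrightarrow> t i \<noteq> t j"
      using AE_distinct_arrivals[of "{1..n}"] by (auto intro!: AE_finite_allI AE_impI)
    then show ?thesis
      by eventually_elim (auto simp: inj_on_def)
  qed
  have range: "AE t in ?M. \<forall>i\<in>{1..n}. t i \<in> {0..1}"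
    by (rule AE_finite_allI) (simp, rule AE_PiM_component, use AE_unif prob_space_unif in auto)
  \<comment> \<open>The payoff never exceeds \<open>x 1\<close>, so the loss is nonnegative and its
    Bochner and nonnegative integrals agree.\<close>
  have "ennreal (x 1 - (\<integral>t. best_only_pricing f n x t \<partial>?M)) =
      (\<integral>\<^sup>+t. ennreal (x 1 - best_only_pricing f n x t) \<partial>?M)"
  proof -
    have "(\<integral>t. x 1 - best_only_pricing f n x t \<partial>?M) = x 1 - (\<integral>t. best_only_pricing f n x t \<partial>?M)"
      using Q.prob_space by (subst Bochner_Integration.integral_diff[OF Q.integrable_const int]) simp
    moreover have "integrable ?M (\<lambda>t. x 1 - best_only_pricing f n x t)"
      by (intro Bochner_Integration.integrable_diff Q.integrable_const int)
    ultimately show ?thesis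
      using bounds nn_integral_eq_integral[of ?M "\<lambda>t. x 1 - best_only_pricing f n x t"] by simp
  qed
  also have "\<dots> \<le> (\<integral>\<^sup>+t. A (t 1) + (\<Sum>m=2..n. R B 1 m {2..<m} t)
      + (\<Sum>m=3..n. R C 1 m {2..<m} t) + (\<Sum>m=3..n. R C 2 m (insert 1 {3..<m}) t) \<partial>?M)"
    using distinct range
  proof (intro nn_integral_mono_AE, eventually_elim)
    case (elim t)
    then show ?case
      using best_only_pricing_loss_le[OF n x _ _ f_mono v, of t] by (simp add: A_def B_def C_def R_def)
  qed
  also have "\<dots> = (\<integral>\<^sup>+t. A (t 1) \<partial>?M) + (\<Sum>m=2..n. integral\<^sup>N ?M (R B 1 m {2..<m}))
      + (\<Sum>m=3..n. integral\<^sup>N ?M (R C 1 m {2..<m})) + (\<Sum>m=3..n. integral\<^sup>N ?M (R C 2 m (insert 1 {3..<m})))"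
  proof -
    have [measurable]: "(\<lambda>t. t 1) \<in> borel_measurable ?M"
      using n by (intro arr) auto
    have 1: "(\<lambda>t. A (t 1)) \<in> borel_measurable ?M"
      by measurable
    have 2: "(\<lambda>t. \<Sum>m=2..n. R B 1 m {2..<m} t) \<in> borel_measurable ?M"
      "(\<lambda>t. \<Sum>m=3..n. R C 1 m {2..<m} t) \<in> borel_measurable ?M"
      "(\<lambda>t. \<Sum>m=3..n. R C 2 m (insert 1 {3..<m}) t) \<in> borel_measurable ?M"
      by (intro borel_measurable_sum R_meas; force)+
    have 3: "(\<integral>\<^sup>+t. (\<Sum>m=2..n. R B 1 m {2..<m} t) \<partial>?M) = (\<Sum>m=2..n. integral\<^sup>N ?M (R B 1 m {2..<m}))"
      "(\<integral>\<^sup>+t. (\<Sum>m=3..n. R C 1 m {2..<m} t) \<partial>?M) = (\<Sum>m=3..n. integral\<^sup>N ?M (R C 1 m {2..<m}))"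
      "(\<integral>\<^sup>+t. (\<Sum>m=3..n. R C 2 m (insert 1 {3..<m}) t) \<partial>?M) = (\<Sum>m=3..n. integral\<^sup>N ?M (R C 2 m (insert 1 {3..<m})))"
      by (intro nn_integral_sum R_meas; force)+
    show ?thesis
      unfolding 3[symmetric] by (simp only: nn_integral_add 1 2 borel_measurable_add)
  qed
  also have "(\<integral>\<^sup>+t. A (t 1) \<partial>?M) = (\<integral>\<^sup>+y. A y \<partial>unif)"
  proof -
    have "distr ?M unif (\<lambda>t. t 1) = unif"
      using n distr_PiM_component[of "{1..n}" "\<lambda>_. unif" 1] prob_space_unif by simp
    moreover have "(\<lambda>t. t 1) \<in> ?M \<rightarrow>\<^sub>M unif"
      using n by (intro measurable_component_singleton) auto
    ultimately show ?thesis
      using nn_integral_distr[of "\<lambda>t. t 1" ?M unif A] by simp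
  qed
  finally have *: "ennreal (x 1 - (\<integral>t. best_only_pricing f n x t \<partial>?M)) \<le> (\<integral>\<^sup>+y. A y \<partial>unif) +
      (\<Sum>m=2..n. integral\<^sup>N ?M (R B 1 m {2..<m})) + (\<Sum>m=3..n. integral\<^sup>N ?M (R C 1 m {2..<m})) +
      (\<Sum>m=3..n. integral\<^sup>N ?M (R C 2 m (insert 1 {3..<m})))" .
  have B_sum: "(\<Sum>m=2..n. integral\<^sup>N ?M (R B 1 m {2..<m})) \<le> (\<integral>\<^sup>+y. B y * ennreal (- ln y) \<partial>unif)"
  proof -
    have "(\<Sum>m=2..n. integral\<^sup>N ?M (R B 1 m {2..<m})) =
      (\<Sum>m=2..n. \<integral>\<^sup>+y. B y * ennreal ((1 - y) ^ Suc (m - 2) / Suc (m - 2)) \<partial>unif)"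
      by (intro sum.cong refl, subst R_int) auto
    also have "\<dots> \<le> (\<integral>\<^sup>+y. B y * ennreal (- ln y) \<partial>unif)"
      by (intro sums sum_record_weights_le) auto
    finally show ?thesis .
  qed
  have C_sum: "(\<Sum>m=3..n. integral\<^sup>N ?M (R C k m (S m))) \<le> (\<integral>\<^sup>+y. C y * ennreal (y - 1 - ln y) \<partial>unif)"
    if "k \<in> {1, 2}" "\<And>m. m \<in> {3..n} \<Longrightarrow> S m \<subseteq> {1..n} - {m, k} \<and> card (S m) = m - 2" for k S
  proof -
    have "(\<Sum>m=3..n. integral\<^sup>N ?M (R C k m (S m))) =
      (\<Sum>m=3..n. \<integral>\<^sup>+y. C y * ennreal ((1 - y) ^ Suc (m - 2) / Suc (m - 2)) \<partial>unif)"
    proof (intro sum.cong refl)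
      fix m assume m: "m \<in> {3..n}"
      then have "k \<in> {1..n}" "m \<in> {1..n}" "m \<noteq> k"
        using that(1) by auto
      then show "integral\<^sup>N ?M (R C k m (S m)) =
          (\<integral>\<^sup>+y. C y * ennreal ((1 - y) ^ Suc (m - 2) / Suc (m - 2)) \<partial>unif)"
        using that(2)[OF m] by (subst R_int) auto
    qed
    also have "\<dots> \<le> (\<integral>\<^sup>+y. C y * ennreal (y - 1 - ln y) \<partial>unif)"
      by (intro sums sum_record_weights_le) auto
    finally show ?thesis .
  qed
  have C_double: "(\<integral>\<^sup>+y. C y * ennreal (y - 1 - ln y) \<partial>unif) + (\<integral>\<^sup>+y. C y * ennreal (y - 1 - ln y) \<partial>unif) =
      (\<integral>\<^sup>+y. C y * ennreal (2 * (y - 1 - ln y)) \<partial>unif)"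
  proof -
    have "(\<integral>\<^sup>+y. C y * ennreal (y - 1 - ln y) \<partial>unif) + (\<integral>\<^sup>+y. C y * ennreal (y - 1 - ln y) \<partial>unif) =
      (\<integral>\<^sup>+y. C y * ennreal (y - 1 - ln y) + C y * ennreal (y - 1 - ln y) \<partial>unif)"
      by (rule nn_integral_add[symmetric]) measurable
    also have "\<dots> = (\<integral>\<^sup>+y. C y * ennreal (2 * (y - 1 - ln y)) \<partial>unif)"
    proof (rule nn_integral_cong_AE, rule eventually_mono[OF AE_unif_pos])
      fix y :: real assume "y \<in> {0<..1}"
      then have "0 \<le> y - 1 - ln y"
        using ln_le_minus_one[of y] by simp
      then have "ennreal (2 * (y - 1 - ln y)) = ennreal (y - 1 - ln y) + ennreal (y - 1 - ln y)"
        by (simp flip: ennreal_plus)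
      then show "C y * ennreal (y - 1 - ln y) + C y * ennreal (y - 1 - ln y) = C y * ennreal (2 * (y - 1 - ln y))"
        by (simp add: distrib_left)
    qed
    finally show ?thesis .
  qed
  have "(\<Sum>m=3..n. integral\<^sup>N ?M (R C 1 m {2..<m})) + (\<Sum>m=3..n. integral\<^sup>N ?M (R C 2 m (insert 1 {3..<m})))
      \<le> (\<integral>\<^sup>+y. C y * ennreal (2 * (y - 1 - ln y)) \<partial>unif)"
    unfolding C_double[symmetric]
    by (intro add_mono C_sum[of 1 "\<lambda>m. {2..<m}"] C_sum[of 2 "\<lambda>m. insert 1 {3..<m}"]) auto
  with * B_sum show ?thesis
    unfolding A_def[symmetric] B_def[symmetric] C_def[symmetric] arrival_times_def
    by (elim order_trans) (simp only: add.assoc, intro add_mono order.refl)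
qed

section \<open>Integrals against the record densities\<close>

text \<open>The factor \<open>x\<close> makes the value at 0 equal to the limit 0, whatever
  \<open>ln 0\<close> is. Primitives in which \<open>ln\<close> occurs only inside
  \<open>y * ln y\<close> are therefore continuous down to 0, which covers
  \<open>b = 0\<close>.\<close>

lemma continuous_on_mult_ln: "continuous_on {0..} (\<lambda>x::real. x * ln x)"
  unfolding continuous_on_def
proof
  fix x :: real assume x: "x \<in> {0..}"
  show "((\<lambda>x. x * ln x) \<longlongrightarrow> x * ln x) (at x within {0..})"
  proof (cases "x = 0")
    case True
    have "((\<lambda>x::real. x * ln x) \<longlongrightarrow> 0) (at_right 0)"
      by real_asymp
    moreover have "{0..} - {0} = {0<..} - {0::real}"
      by auto
    ultimately show ?thesis
      using True by (simp add: at_within_def)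
  next
    case False
    then show ?thesis
      using x by (intro tendsto_intros) auto
  qed
qed

text \<open>The derivative is required only in the open interval because the logarithmic densities
  are unbounded at 0; the endpoints are null sets.\<close>

lemma nn_integral_unif_le:
  fixes g :: "real \<Rightarrow> ennreal" and F \<phi> :: "real \<Rightarrow> real"
  assumes lu: "0 \<le> l" "l \<le> u" "u \<le> 1" and g: "g \<in> borel_measurable borel"
    and zero: "\<And>y. y \<in> {0<..<1} - {l..u} \<Longrightarrow> g y = 0"
    and le: "\<And>y. y \<in> {l<..<u} \<Longrightarrow> g y \<le> ennreal (\<phi> y)"
    and nonneg: "\<And>y. y \<in> {l<..<u} \<Longrightarrow> 0 \<le> \<phi> y"
    and cont: "continuous_on {l..u} F"
    and deriv: "\<And>y. y \<in> {l<..<u} \<Longrightarrow> (F has_real_derivative \<phi> y) (at y)"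
  shows "(\<integral>\<^sup>+y. g y \<partial>unif) \<le> ennreal (F u - F l)"
proof -
  have "(\<phi> has_integral (F u - F l)) {l..u}"
    using lu cont deriv
    by (intro fundamental_theorem_of_calculus_interior) (auto simp: has_real_derivative_iff_has_vector_derivative)
  then have *: "(\<integral>\<^sup>+y. ennreal (\<phi> y) * indicator {l<..<u} y \<partial>lborel) = ennreal (F u - F l)"
    using nonneg by (intro nn_integral_has_integral_lebesgue') (auto simp: has_integral_Icc_iff_Ioo)
  have "(\<integral>\<^sup>+y. g y \<partial>unif) = (\<integral>\<^sup>+y. g y * indicator {0..1} y \<partial>lborel)"
    by (rule nn_integral_unif[OF g])
  also have "\<dots> \<le> (\<integral>\<^sup>+y. ennreal (\<phi> y) * indicator {l<..<u} y \<partial>lborel)"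
  proof (rule nn_integral_mono_AE)
    have "AE y in lborel. y \<noteq> 0" "AE y in lborel. y \<noteq> 1" "AE y in lborel. y \<noteq> l" "AE y in lborel. y \<noteq> u"
      by (rule AE_lborel_singleton)+
    then show "AE y in lborel. g y * indicator {0..1} y \<le> ennreal (\<phi> y) * indicator {l<..<u} y"
    proof eventually_elim
      case (elim y)
      then show ?case
        using zero[of y] le[of y] lu by (cases "y \<in> {l<..<u}"; cases "y \<in> {0..1}") (auto simp: indicator_def)
    qed
  qed
  finally show ?thesis using * by simp
qed

text \<open>The tails \<open>qtwo\<close> and \<open>qthree\<close> of the two record sub-densities bound the probabilities that
  a picked item arrives after time \<open>y\<close> and is not the best item, or not one of the two best.\<close>

definition qtwo :: "real \<Rightarrow> real" where
  "qtwo y = 1 - y + y * ln y"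

definition qthree :: "real \<Rightarrow> real" where
  "qthree y = 1 - y\<^sup>2 + 2 * (y * ln y)"

lemma qtwo_deriv: "0 < y \<Longrightarrow> (qtwo has_real_derivative ln y) (at y)"
  unfolding qtwo_def by (auto intro!: derivative_eq_intros)

lemma qthree_deriv: "0 < y \<Longrightarrow> (qthree has_real_derivative - (2 * (y - 1 - ln y))) (at y)"
  unfolding qthree_def by (auto intro!: derivative_eq_intros simp: algebra_simps)

lemma qtwo_cont: "continuous_on {0..} qtwo"
  unfolding qtwo_def by (intro continuous_intros continuous_on_mult_ln)

lemma qthree_cont: "continuous_on {0..} qthree"
  unfolding qthree_def by (intro continuous_intros continuous_on_mult_ln)

text \<open>The indicator vanishes before \<open>b\<close>, and \<open>- qtwo\<close> is a primitive
  of the density \<open>- ln y\<close> with value 0 at 1.\<close>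

lemma nn_integral_first_loss_le:
  fixes f :: "real \<Rightarrow> real"
  assumes "0 \<le> b" "b \<le> 1" "0 \<le> w" "f \<in> borel_measurable borel"
    and f: "\<And>y. y \<in> {0<..<b} \<Longrightarrow> v < f y"
  shows "(\<integral>\<^sup>+y. ennreal w * indicator {y. f y \<le> v} y * ennreal (- ln y) \<partial>unif) \<le> ennreal (w * qtwo b)"
proof -
  note [measurable] = assms(4)
  have "(\<integral>\<^sup>+y. ennreal w * indicator {y. f y \<le> v} y * ennreal (- ln y) \<partial>unif) \<le>
      ennreal (- w * qtwo 1 - (- w * qtwo b))"
  proof (rule nn_integral_unif_le[where \<phi> = "\<lambda>y. w * (- ln y)" and F = "\<lambda>y. - w * qtwo y"])
    show "ennreal w * indicator {y. f y \<le> v} y * ennreal (- ln y) = 0" if "y \<in> {0<..<1} - {b..1}" for y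
    proof -
      have "y \<in> {0<..<b}" using that by auto
      then have "\<not> f y \<le> v" using f[of y] by simp
      then show ?thesis by simp
    qed
    show "ennreal w * indicator {y. f y \<le> v} y * ennreal (- ln y) \<le> ennreal (w * (- ln y))"
      if "y \<in> {b<..<1}" for y
      using that assms by (auto simp: indicator_def mult_nonneg_nonpos simp flip: ennreal_mult)
    show "((\<lambda>y. - w * qtwo y) has_real_derivative w * (- ln y)) (at y)" if "y \<in> {b<..<1}" for y
      using that assms qtwo_deriv[of y] by (auto intro!: derivative_eq_intros)
    show "continuous_on {b..1} (\<lambda>y. - w * qtwo y)"
      by (intro continuous_intros continuous_on_subset[OF qtwo_cont]) (use assms in auto)
  qed (use assms in \<open>auto simp: mult_nonneg_nonpos\<close>)
  then show ?thesis
    by (simp add: qtwo_def)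
qed

text \<open>Integration by parts for a majorant \<open>h\<close> of \<open>v - f\<close>:
  \<open>- qthree\<close> is a primitive of the density, \<open>M\<close> one of
  \<open>h' * qthree\<close>, and the boundary terms vanish since \<open>h b = 0\<close> and
  \<open>qthree 1 = 0\<close>.\<close>

lemma nn_integral_later_loss_le:
  fixes f :: "real \<Rightarrow> real"
  assumes b: "0 \<le> b" "b \<le> 1" and "f \<in> borel_measurable borel"
    and f: "\<And>y. y \<in> {0<..<b} \<Longrightarrow> v \<le> f y"
    and h: "\<And>y. y \<in> {b<..<1} \<Longrightarrow> v - f y \<le> h y" "\<And>y. y \<in> {b<..<1} \<Longrightarrow> 0 \<le> h y" "h b = 0"
    and h': "\<And>y. (h has_real_derivative h' y) (at y)"
    and M: "continuous_on {0..} M" "\<And>y. 0 < y \<Longrightarrow> (M has_real_derivative h' y * qthree y) (at y)"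
  shows "(\<integral>\<^sup>+y. ennreal (v - f y) * ennreal (2 * (y - 1 - ln y)) \<partial>unif) \<le> ennreal (M 1 - M b)"
proof -
  note [measurable] = assms(3)
  have "(\<integral>\<^sup>+y. ennreal (v - f y) * ennreal (2 * (y - 1 - ln y)) \<partial>unif) \<le>
    ennreal ((M 1 - h 1 * qthree 1) - (M b - h b * qthree b))"
  proof (rule nn_integral_unif_le[where \<phi> = "\<lambda>y. h y * (2 * (y - 1 - ln y))" and F = "\<lambda>y. M y - h y * qthree y"])
    have w: "0 \<le> 2 * (y - 1 - ln y)" if "y \<in> {b<..<1}" for y
      using ln_le_minus_one[of y] that b by simp
    show "ennreal (v - f y) * ennreal (2 * (y - 1 - ln y)) = 0" if "y \<in> {0<..<1} - {b..1}" for y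
    proof -
      have "y \<in> {0<..<b}" using that by auto
      then show ?thesis using f[of y] by (simp add: ennreal_neg)
    qed
    show "ennreal (v - f y) * ennreal (2 * (y - 1 - ln y)) \<le> ennreal (h y * (2 * (y - 1 - ln y)))"
      if "y \<in> {b<..<1}" for y
      using h(1,2)[OF that] w[OF that] by (auto simp: ennreal_mult intro!: mult_right_mono ennreal_leI)
    show "0 \<le> h y * (2 * (y - 1 - ln y))" if "y \<in> {b<..<1}" for y
      using h(2)[OF that] w[OF that] by (rule mult_nonneg_nonneg)
    show "((\<lambda>y. M y - h y * qthree y) has_real_derivative h y * (2 * (y - 1 - ln y))) (at y)"
      if "y \<in> {b<..<1}" for y
    proof -
      have "0 < y" using that b by simp
      show ?thesis
        by (rule derivative_eq_intros M(2)[OF \<open>0 < y\<close>] h' qthree_deriv[OF \<open>0 < y\<close>] refl)+ (simp add: algebra_simps)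
    qed
    have "continuous_on {b..1} h"
      using h' by (intro continuous_at_imp_continuous_on ballI DERIV_isCont)
    then show "continuous_on {b..1} (\<lambda>y. M y - h y * qthree y)"
      by (intro continuous_intros continuous_on_subset[OF qthree_cont] continuous_on_subset[OF M(1)]) (use b in auto)
  qed (use b in auto)
  then show ?thesis
    using h(3) by (simp add: qthree_def)
qed

lemma qthree_nonneg:
  assumes "0 < y" "y \<le> 1"
  shows "0 \<le> qthree y"
proof -
  have "qthree 1 \<le> qthree y"
  proof (rule DERIV_nonpos_imp_nonincreasing[where f = qthree])
    fix w assume "y \<le> w" "w \<le> 1"
    then show "\<exists>d. (qthree has_real_derivative d) (at w) \<and> d \<le> 0"
      using assms ln_le_minus_one[of w] by (intro exI[of _ "- (2 * (w - 1 - ln w))"] conjI qthree_deriv) auto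
  qed (use assms in auto)
  then show ?thesis by (simp add: qthree_def)
qed

text \<open>\<open>jlin\<close> and \<open>mtay\<close> arise from two upper bounds on \<open>exp (- b / c) - exp (- y / c)\<close>: the tangent
  at \<open>b\<close>, which is sharp for large \<open>b\<close>, and the cubic Taylor polynomial at 0.\<close>

definition jlin :: "real \<Rightarrow> real" where
  "jlin y = (1 - y)\<^sup>2 / 2 - (1 - y) ^ 3 / 3 - y * qtwo y"

text \<open>As \<open>jlin 1 = 0\<close>, this makes \<open>jlin y\<close> the integral of
  \<open>qthree\<close> from \<open>y\<close> to 1, which is what remains after integrating by parts
  with a linear majorant.\<close>

lemma jlin_deriv: "0 < y \<Longrightarrow> (jlin has_real_derivative - qthree y) (at y)"
  unfolding jlin_def
  by (rule derivative_eq_intros qtwo_deriv refl | simp)+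
    (simp add: qthree_def qtwo_def field_simps power2_eq_square)

lemma jlin_nonneg:
  assumes "0 < y" "y \<le> 1"
  shows "0 \<le> jlin y"
proof -
  have "jlin 1 \<le> jlin y"
  proof (rule DERIV_nonpos_imp_nonincreasing[where f = jlin])
    fix w assume "y \<le> w" "w \<le> 1"
    then show "\<exists>d. (jlin has_real_derivative d) (at w) \<and> d \<le> 0"
      using assms qthree_nonneg[of w] by (intro exI[of _ "- qthree w"] conjI jlin_deriv) auto
  qed (use assms in auto)
  then show ?thesis by (simp add: jlin_def qtwo_def)
qed

definition mtay :: "real \<Rightarrow> real \<Rightarrow> real" where
  "mtay c y = ((y - y ^ 3 / 3 + y * (y * ln y) - y\<^sup>2 / 2)
    - (y\<^sup>2 / 2 - y ^ 4 / 4 + 2 / 3 * y\<^sup>2 * (y * ln y) - 2 / 9 * y ^ 3) / c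
    + (y ^ 3 / 3 - y ^ 5 / 5 + y ^ 3 * (y * ln y) / 2 - y ^ 4 / 8) / (2 * c\<^sup>2)) / c"

lemma mtay_cont: "0 < c \<Longrightarrow> continuous_on {0..} (mtay c)"
  unfolding mtay_def by (intro continuous_intros continuous_on_mult_ln) auto

text \<open>The three brackets of \<open>mtay\<close> are primitives of \<open>qthree y\<close>,
  \<open>y * qthree y\<close> and \<open>y\<^sup>2 * qthree y\<close>; the factor in front of
  \<open>qthree\<close> is the derivative of the cubic Taylor polynomial of
  \<open>1 - exp (- y / c)\<close>.\<close>

lemma mtay_deriv:
  assumes "0 < y"
  shows "(mtay c has_real_derivative (1 - y / c + (y / c)\<^sup>2 / 2) / c * qthree y) (at y)"
proof -
  have L: "((\<lambda>y. y * ln y) has_real_derivative ln y + 1) (at y)"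
    using assms by (auto intro!: derivative_eq_intros)
  have 1: "((\<lambda>y. y - y ^ 3 / 3 + y * (y * ln y) - y\<^sup>2 / 2) has_real_derivative qthree y) (at y)"
    by (rule L derivative_eq_intros refl | simp)+ (simp add: qthree_def field_simps eval_nat_numeral)
  have 2: "((\<lambda>y. y\<^sup>2 / 2 - y ^ 4 / 4 + 2 / 3 * y\<^sup>2 * (y * ln y) - 2 / 9 * y ^ 3)
      has_real_derivative y * qthree y) (at y)"
    by (rule L derivative_eq_intros refl | simp)+ (simp add: qthree_def field_simps eval_nat_numeral)
  have 3: "((\<lambda>y. y ^ 3 / 3 - y ^ 5 / 5 + y ^ 3 * (y * ln y) / 2 - y ^ 4 / 8)
      has_real_derivative y\<^sup>2 * qthree y) (at y)"
    by (rule L derivative_eq_intros refl | simp)+ (simp add: qthree_def field_simps eval_nat_numeral)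
  have "(mtay c has_real_derivative (qthree y - y * qthree y / c + y\<^sup>2 * qthree y / (2 * c\<^sup>2)) / c) (at y)"
    unfolding mtay_def by (intro DERIV_cdivide DERIV_add DERIV_diff 1 2 3)
  moreover have "(qthree y - y * qthree y / c + y\<^sup>2 * qthree y / (2 * c\<^sup>2)) / c =
      (1 - y / c + (y / c)\<^sup>2 / 2) / c * qthree y"
    by (cases "c = 0") (simp_all add: field_simps)
  ultimately show ?thesis by simp
qed

text \<open>The third-order Lagrange remainder has the sign of \<open>(- z) ^ 3\<close>.\<close>

lemma exp_minus_le_quadratic:
  fixes z :: real
  assumes "0 \<le> z"
  shows "exp (- z) \<le> 1 - z + z\<^sup>2 / 2"
proof -
  obtain t where "exp (- z) = (\<Sum>m<3. (- z) ^ m / fact m) + exp t / fact 3 * (- z) ^ 3"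
    using Maclaurin_exp_le[of "- z" 3] by blast
  then show ?thesis
    using assms by (simp add: eval_nat_numeral)
qed

lemma quadratic_nonneg: "0 \<le> 1 - z + z\<^sup>2 / (2 :: real)"
proof -
  have "0 \<le> (1 + (1 - z)\<^sup>2) / 2"
    by simp
  also have "\<dots> = 1 - z + z\<^sup>2 / 2"
    by (simp add: power2_eq_square field_simps)
  finally show ?thesis .
qed

lemma mtay_mono:
  assumes b: "0 \<le> b" "b \<le> 1" and c: "0 < c"
  shows "mtay c b \<le> mtay c 1"
proof (rule DERIV_nonneg_imp_increasing_open[where f = "mtay c"])
  fix y assume y: "b < y" "y < 1"
  then have "0 < y" using b by simp
  then show "\<exists>d. (mtay c has_real_derivative d) (at y) \<and> 0 \<le> d"
    using y c qthree_nonneg[of y] quadratic_nonneg[of "y / c"]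
    by (intro exI[of _ "(1 - y / c + (y / c)\<^sup>2 / 2) / c * qthree y"] conjI mtay_deriv
      mult_nonneg_nonneg divide_nonneg_pos) auto
qed (use b continuous_on_subset[OF mtay_cont[OF c]] in auto)

lemma nn_integral_later_loss_exp_le:
  assumes b: "0 \<le> b" "b \<le> 1" and c: "0 < c"
  shows "(\<integral>\<^sup>+y. ennreal (exp (- b / c) - exp (- y / c)) * ennreal (2 * (y - 1 - ln y)) \<partial>unif)
      \<le> ennreal (exp (- b / c) * jlin b / c)"
    and "(\<integral>\<^sup>+y. ennreal (exp (- b / c) - exp (- y / c)) * ennreal (2 * (y - 1 - ln y)) \<partial>unif)
      \<le> ennreal (mtay c 1 - mtay c b)"
proof -
  have mono: "exp (- b / c) \<le> exp (- y / c)" if "y \<in> {0<..<b}" for y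
    using that c by (simp add: divide_right_mono)
  have "(\<integral>\<^sup>+y. ennreal (exp (- b / c) - exp (- y / c)) * ennreal (2 * (y - 1 - ln y)) \<partial>unif)
      \<le> ennreal (- (exp (- b / c) / c * jlin 1) - - (exp (- b / c) / c * jlin b))"
  proof (rule nn_integral_later_loss_le[where M = "\<lambda>y. - (exp (- b / c) / c * jlin y)" and h = "\<lambda>y. exp (- b / c) * ((y - b) / c)" and h' = "\<lambda>_. exp (- b / c) / c"])
    \<comment> \<open>By convexity, \<open>exp (- y / c)\<close> lies above its tangent at
      \<open>b\<close>.\<close>
    show "exp (- b / c) - exp (- y / c) \<le> exp (- b / c) * ((y - b) / c)" if "y \<in> {b<..<1}" for y
    proof -
      have "exp (- b / c) * (1 - (y - b) / c) \<le> exp (- b / c) * exp (- ((y - b) / c))"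
        using exp_ge_add_one_self[of "- ((y - b) / c)"] by (intro mult_left_mono) auto
      also have "\<dots> = exp (- y / c)"
        using c by (simp flip: exp_add add: field_simps)
      finally show ?thesis by (simp add: algebra_simps)
    qed
    show "((\<lambda>y. exp (- b / c) * ((y - b) / c)) has_real_derivative exp (- b / c) / c) (at y)" for y
      using c by (auto intro!: derivative_eq_intros)
    show "continuous_on {0..} (\<lambda>y. - (exp (- b / c) / c * jlin y))"
      unfolding jlin_def by (intro continuous_intros qtwo_cont) auto
    show "((\<lambda>y. - (exp (- b / c) / c * jlin y)) has_real_derivative exp (- b / c) / c * qthree y) (at y)"
      if "0 < y" for y
      by (rule derivative_eq_intros jlin_deriv[OF that] refl)+ simp
  qed (use b c mono in auto)
  then show "(\<integral>\<^sup>+y. ennreal (exp (- b / c) - exp (- y / c)) * ennreal (2 * (y - 1 - ln y)) \<partial>unif)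
      \<le> ennreal (exp (- b / c) * jlin b / c)"
    by (simp add: jlin_def qtwo_def)
next
  have mono: "exp (- b / c) \<le> exp (- y / c)" if "y \<in> {0<..<b}" for y
    using that c by (simp add: divide_right_mono)
  \<comment> \<open>The cubic Taylor polynomial of \<open>1 - exp (- y / c)\<close>. Its derivative
    is at least \<open>exp (- y / c) / c\<close>, so its increments dominate those of
    \<open>1 - exp (- y / c)\<close>.\<close>
  define \<Psi> where "\<Psi> y = y / c - (y / c)\<^sup>2 / 2 + (y / c) ^ 3 / 6" for y
  have \<Psi>_deriv: "(\<Psi> has_real_derivative (1 - y / c + (y / c)\<^sup>2 / 2) / c) (at y)" for y
    unfolding \<Psi>_def using c by (auto intro!: derivative_eq_intros simp: field_simps eval_nat_numeral)
  show "(\<integral>\<^sup>+y. ennreal (exp (- b / c) - exp (- y / c)) * ennreal (2 * (y - 1 - ln y)) \<partial>unif)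
      \<le> ennreal (mtay c 1 - mtay c b)"
  proof (rule nn_integral_later_loss_le[where M = "mtay c" and h = "\<lambda>y. \<Psi> y - \<Psi> b" and h' = "\<lambda>y. (1 - y / c + (y / c)\<^sup>2 / 2) / c"])
    show "exp (- b / c) - exp (- y / c) \<le> \<Psi> y - \<Psi> b" if "y \<in> {b<..<1}" for y
    proof -
      have "\<Psi> b + exp (- b / c) \<le> \<Psi> y + exp (- y / c)"
      proof (rule DERIV_nonneg_imp_nondecreasing[where f = "\<lambda>y. \<Psi> y + exp (- y / c)"])
        fix w assume "b \<le> w" "w \<le> y"
        have "((\<lambda>y. \<Psi> y + exp (- y / c)) has_real_derivative
            (1 - w / c + (w / c)\<^sup>2 / 2) / c + exp (- w / c) * (- 1 / c)) (at w)"
          using c by (intro DERIV_add \<Psi>_deriv) (auto intro!: derivative_eq_intros)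
        also have "(1 - w / c + (w / c)\<^sup>2 / 2) / c + exp (- w / c) * (- 1 / c) =
            (1 - w / c + (w / c)\<^sup>2 / 2 - exp (- w / c)) / c"
          by (simp add: diff_divide_distrib)
        finally have "((\<lambda>y. \<Psi> y + exp (- y / c)) has_real_derivative
            (1 - w / c + (w / c)\<^sup>2 / 2 - exp (- w / c)) / c) (at w)" .
        moreover have "exp (- w / c) \<le> 1 - w / c + (w / c)\<^sup>2 / 2"
          using exp_minus_le_quadratic[of "w / c"] b c \<open>b \<le> w\<close> by simp
        ultimately show "\<exists>d. ((\<lambda>y. \<Psi> y + exp (- y / c)) has_real_derivative d) (at w) \<and> 0 \<le> d"
          using c by (intro exI conjI) (assumption, simp)
      qed (use that in auto)
      then show ?thesis by simp
    qed
    show "0 \<le> \<Psi> y - \<Psi> b" if "y \<in> {b<..<1}" for y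
    proof -
      have "\<Psi> b \<le> \<Psi> y"
        using c that \<Psi>_deriv quadratic_nonneg by (intro DERIV_nonneg_imp_nondecreasing[of b y \<Psi>]) (auto intro!: exI divide_nonneg_pos)
      then show ?thesis by simp
    qed
    show "((\<lambda>y. \<Psi> y - \<Psi> b) has_real_derivative (1 - y / c + (y / c)\<^sup>2 / 2) / c) (at y)" for y
      using DERIV_diff[OF \<Psi>_deriv[of y] DERIV_const[of "\<Psi> b"]] by simp
  qed (use b mono mtay_cont[OF c] mtay_deriv in auto)
qed

text \<open>This expression collects what remains of the dependence on \<open>b\<close> in the small
  case once \<open>exp (- a / c) * qtwo b - qtwo b\<close> is split off. It is 0 at
  \<open>b = 0\<close> and decreases.\<close>

lemma taylor_loss_decreasing:
  assumes b: "0 \<le> b" "b \<le> 1" and c: "0 < c"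
  shows "qtwo b * (1 - exp (- b / c)) - mtay c b \<le> 0"
proof -
  have "qtwo b * (1 - exp (- b / c)) - mtay c b \<le> qtwo 0 * (1 - exp (- 0 / c)) - mtay c 0"
  proof (rule DERIV_nonpos_imp_decreasing_open[where f = "\<lambda>b. qtwo b * (1 - exp (- b / c)) - mtay c b"])
    fix y assume y: "0 < y" "y < b"
    let ?e = "exp (- y / c)" and ?p = "1 - y / c + (y / c)\<^sup>2 / 2"
    have E: "((\<lambda>y. exp (- y / c)) has_real_derivative - (?e / c)) (at y)"
      using c by (auto intro!: derivative_eq_intros)
    have D: "((\<lambda>y. qtwo y * (1 - exp (- y / c)) - mtay c y) has_real_derivative
        ln y * (1 - ?e) + qtwo y * (?e / c) - ?p / c * qthree y) (at y)"
      by (rule derivative_eq_intros qtwo_deriv[OF y(1)] mtay_deriv[OF y(1)] E refl)+ simp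
    have ln: "ln y \<le> 0" "ln y \<le> y - 1" "- ln y \<le> 1 / y - 1"
      using y b ln_le_minus_one[of y] ln_le_minus_one[of "1 / y"] by (auto simp: ln_div)
    have "0 \<le> qthree y"
      using y b by (intro qthree_nonneg) auto
    then have "?e / c * qthree y \<le> ?p / c * qthree y"
      using exp_minus_le_quadratic[of "y / c"] y c by (intro mult_right_mono divide_right_mono) auto
    \<comment> \<open>With the Taylor factor replaced by the smaller exponential, the derivative
      regroups into two nonpositive terms; the first is so because
      \<open>(1 + u) * exp (- u) \<le> 1\<close>.\<close>
    moreover have "ln y * (1 - ?e) + qtwo y * (?e / c) - ?e / c * qthree y =
        ln y * (1 - (1 + y / c) * ?e) - ?e / c * (y * (1 - y))"
      using c by (simp add: qtwo_def qthree_def field_simps power2_eq_square)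
    moreover have "ln y * (1 - (1 + y / c) * ?e) \<le> 0"
    proof -
      have "(1 + y / c) * ?e \<le> exp (y / c) * ?e"
        using exp_ge_add_one_self[of "y / c"] by (intro mult_right_mono) auto
      also have "\<dots> = 1"
        by (simp flip: exp_add)
      finally show ?thesis
        using ln(1) by (simp add: mult_nonpos_nonneg)
    qed
    moreover have "0 \<le> ?e / c * (y * (1 - y))"
      using y b c by simp
    ultimately show "\<exists>d. ((\<lambda>y. qtwo y * (1 - exp (- y / c)) - mtay c y) has_real_derivative d) (at y) \<and> d \<le> 0"
      using D by (intro exI conjI) (assumption, linarith)
  next
    show "continuous_on {0..b} (\<lambda>y. qtwo y * (1 - exp (- y / c)) - mtay c y)"
      by (intro continuous_intros continuous_on_subset[OF qtwo_cont] continuous_on_subset[OF mtay_cont[OF c]])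
        (use c in auto)
  qed (use b in auto)
  then show ?thesis
    by (simp add: mtay_def)
qed

section \<open>Numerical estimates of the bound as a function of \<open>a\<close> and
  \<open>b\<close>\<close>

text \<open>The left side is the first Pade approximant of \<open>ln (1 + y)\<close>; the difference
  has derivative \<open>w\<^sup>2 / ((1 + w) * (2 + w)\<^sup>2)\<close>.\<close>

lemma ln_one_plus_ge:
  fixes y :: real
  assumes "0 \<le> y"
  shows "2 * y / (2 + y) \<le> ln (1 + y)"
proof -
  have "ln (1 + 0) - 2 * 0 / (2 + 0) \<le> ln (1 + y) - 2 * y / (2 + y)"
  proof (rule DERIV_nonneg_imp_nondecreasing[where f = "\<lambda>y. ln (1 + y) - 2 * y / (2 + y)"])
    fix w :: real assume w: "0 \<le> w" "w \<le> y"
    have "((\<lambda>y. ln (1 + y) - 2 * y / (2 + y)) has_real_derivative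
        1 / (1 + w) - 4 / (2 + w)\<^sup>2) (at w)"
      using w by (auto intro!: derivative_eq_intros simp: power2_eq_square)
    moreover have "1 / (1 + w) - 4 / (2 + w)\<^sup>2 = w\<^sup>2 / ((1 + w) * (2 + w)\<^sup>2)"
      using w by (simp add: field_simps) (simp add: power2_eq_square algebra_simps)
    ultimately show "\<exists>d. ((\<lambda>y. ln (1 + y) - 2 * y / (2 + y)) has_real_derivative d) (at w) \<and> 0 \<le> d"
      using w by (intro exI conjI) (assumption, simp)
  qed (use assms in auto)
  then show ?thesis by simp
qed

lemma exp_ge_quartic:
  fixes x :: real
  assumes "0 \<le> x"
  shows "1 + x + x\<^sup>2 / 2 + x ^ 3 / 6 + x ^ 4 / 24 \<le> exp x"
proof -
  obtain t where "exp x = (\<Sum>m<5. x ^ m / fact m) + exp t / fact 5 * x ^ 5"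
    using Maclaurin_exp_le[of x 5] by blast
  moreover have "0 \<le> exp t / fact 5 * x ^ 5"
    using assms by simp
  ultimately show ?thesis
    by (simp add: eval_nat_numeral)
qed

text \<open>The coefficient 0.21 absorbs all terms from the cubic one on; the range up to 0.71
  covers the values of \<open>p / c\<close> that occur for \<open>b \<ge> 0.18\<close>.\<close>

lemma exp_le_cubic:
  fixes x :: real
  assumes "0 \<le> x" "x \<le> 0.71"
  shows "exp x \<le> 1 + x + x\<^sup>2 / 2 + 0.21 * x ^ 3"
proof -
  obtain t where t: "\<bar>t\<bar> \<le> \<bar>x\<bar>" "exp x = (\<Sum>m<5. x ^ m / fact m) + exp t / fact 5 * x ^ 5"
    using Maclaurin_exp_le[of x 5] by blast
  have "exp t \<le> exp 1"
    using t(1) assms by simp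
  then have "exp t \<le> 3"
    using exp_le by linarith
  then have "exp t / fact 5 * x ^ 5 \<le> 3 / fact 5 * x ^ 5"
    using assms by (intro mult_right_mono divide_right_mono) auto
  then have "exp x \<le> 1 + x + x\<^sup>2 / 2 + x ^ 3 * (1 / 6 + x / 24 + x\<^sup>2 / 40)"
    unfolding t(2) by (simp add: eval_nat_numeral algebra_simps)
  also have "x ^ 3 * (1 / 6 + x / 24 + x\<^sup>2 / 40) \<le> x ^ 3 * 0.21"
  proof (rule mult_left_mono)
    have "x\<^sup>2 \<le> 0.71\<^sup>2"
      using assms by (intro power_mono) auto
    then show "1 / 6 + x / 24 + x\<^sup>2 / 40 \<le> 0.21"
      using assms by (simp add: power2_eq_square)
  qed (use assms in simp)
  finally show ?thesis by (simp add: mult.commute)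
qed

lemma exp_one_bound: "exp (- 1) \<le> (0.36788 :: real)"
proof -
  obtain t where "exp (1::real) = (\<Sum>m<10. 1 ^ m / fact m) + exp t / fact 10 * 1 ^ 10"
    using Maclaurin_exp_le[of 1 10] by blast
  then have "(\<Sum>m<10. 1 ^ m / fact m) \<le> exp (1::real)"
    by simp
  then have "1 / 0.36788 \<le> exp (1::real)"
    by (simp add: eval_nat_numeral)
  then show ?thesis
    by (simp add: exp_minus field_simps)
qed

lemma exp_last_threshold_bound: "0.1946 \<le> exp (- (1000 / 611) :: real)"
proof -
  \<comment> \<open>A quarter of the exponent keeps the Taylor sum short; its even-order remainder
    is nonnegative, and the fourth power restores the exponent.\<close>
  define z :: real where "z = - 250 / 611"
  obtain t where "exp z = (\<Sum>m<6. z ^ m / fact m) + exp t / fact 6 * z ^ 6"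
    using Maclaurin_exp_le[of z 6] by blast
  moreover have "0 \<le> exp t / fact 6 * z ^ 6"
    by simp
  ultimately have "(\<Sum>m<6. z ^ m / fact m) \<le> exp z"
    by linarith
  then have "0.66419 \<le> exp z"
    by (simp add: eval_nat_numeral z_def)
  then have "0.66419 ^ 4 \<le> exp z ^ 4"
    by (intro power_mono) auto
  also have "exp z ^ 4 = exp (- (1000 / 611))"
    by (simp add: z_def flip: exp_of_nat_mult)
  finally show ?thesis
    by (simp add: eval_nat_numeral)
qed

text \<open>The polynomial has a local minimum of about 5 near 0.4, so it is expanded around that point.\<close>

lemma regret_polynomial_nonneg:
  fixes d :: real
  assumes "0 \<le> d" "d \<le> 0.82"
  shows "0 \<le> 52 - 867 * d ^ 2 + 1303 * d ^ 3 + 550 * d ^ 4 - 226 * d ^ 5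
    - 526 * d ^ 6 - 550 * d ^ 7 - 245 * d ^ 8 - 10 * d ^ 9" (is "0 \<le> ?Q")
proof -
  define e where "e = d - 0.4"
  have d: "d = e + 2 / 5" by (simp add: e_def)
  have Q: "?Q = 2038656 / 390625 - 597288 / 78125 * e + 11422119 / 15625 * e ^ 2 + 1598083 / 3125 * e ^ 3
    - 1780214 / 625 * e ^ 4 - 530842 / 125 * e ^ 5 - 80434 / 25 * e ^ 6
    - 6958 / 5 * e ^ 7 - 281 * e ^ 8 - 10 * e ^ 9"
    unfolding d by (simp add: eval_nat_numeral field_simps)
  show ?thesis
  proof (cases "0 \<le> e")
    case True
    have e: "e \<le> 21 / 50" using assms by (simp add: e_def)
    \<comment> \<open>Bounding each power by the preceding one turns the claim into linear
      arithmetic in the powers of \<open>e\<close>; the same is done for \<open>- e\<close> on the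
      other side.\<close>
    have pw: "e ^ Suc k \<le> 21 / 50 * e ^ k" for k
      using mult_right_mono[OF e, of "e ^ k"] True by simp
    show ?thesis
      unfolding Q using pw[of 2, simplified] pw[of 3, simplified] pw[of 4, simplified]
        pw[of 5, simplified] pw[of 6, simplified] pw[of 7, simplified] pw[of 8, simplified] e True
        zero_le_power[OF True, of 2]
      by linarith
  next
    case False
    define s where "s = - e"
    have e_eq: "e = - s" and s: "0 \<le> s" "s \<le> 2 / 5"
      using assms False by (auto simp: s_def e_def)
    have pw: "s ^ Suc k \<le> 2 / 5 * s ^ k" for k
      using mult_right_mono[OF s(2), of "s ^ k"] s by simp
    have s0: "0 \<le> s ^ k" for k
      using s by simp
    have "0 \<le> 2038656 / 390625 + 597288 / 78125 * s + 11422119 / 15625 * s ^ 2 - 1598083 / 3125 * s ^ 3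
      - 1780214 / 625 * s ^ 4 + 530842 / 125 * s ^ 5 - 80434 / 25 * s ^ 6 + 6958 / 5 * s ^ 7
      - 281 * s ^ 8 + 10 * s ^ 9"
      using pw[of 2, simplified] pw[of 3, simplified] pw[of 5, simplified] pw[of 7, simplified]
        s s0[of 2] s0[of 3] s0[of 4] s0[of 5] s0[of 7] s0[of 9]
      by linarith
    then show ?thesis
      unfolding Q e_eq by simp
  qed
qed

text \<open>The final inequality of the large case with \<open>d = 1 - b\<close>:
  \<open>d\<^sup>2 / 2 + d ^ 3 / 6\<close> is a lower bound for \<open>qtwo b\<close>, and the
  subtracted product bounds from below the term carrying the factor
  \<open>exp (- b / c)\<close>.\<close>

lemma regret_polynomial_le:
  fixes d :: real
  assumes d: "0 \<le> d" "d \<le> 0.82"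
  shows "0.611 * 0.36788 + 0.36788 * (d\<^sup>2 / 2 + d ^ 3 / 6) *
      (1 + 1.6367 * (d\<^sup>2 / 2 + d ^ 3 / 6) / 2 + 0.21 * (1.6367 * (d\<^sup>2 / 2 + d ^ 3 / 6))\<^sup>2)
    - 0.1946 * (1 + 1.6366 * d + 1.3392 * d\<^sup>2 + 0.7306 * d ^ 3 + 0.2989 * d ^ 4)
      * (d\<^sup>2 / 2 + d ^ 3 / 6 - 1.6367 * d ^ 4 / 6) \<le> 0.23" (is "?L \<le> _")
proof -
  \<comment> \<open>These are the exact coefficients of 0.23 minus the left side. The integer
    polynomial has 10000 times these coefficients, rounded down, which is safe for
    \<open>d \<ge> 0\<close>.\<close>
  have "0 \<le> 130633 / 25000000 - 1083 / 12500 * d ^ 2 + 6518059 / 50000000 * d ^ 3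
    + 330223603 / 6000000000 * d ^ 4 - 11265173051 / 500000000000 * d ^ 5
    - 945758048248537 / 18000000000000000 * d ^ 6 - 329743348764179 / 6000000000000000 * d ^ 7
    - 146937480355393 / 6000000000000000 * d ^ 8 - 17245762119131 / 18000000000000000 * d ^ 9"
    using regret_polynomial_nonneg[OF d] zero_le_power[OF d(1), of 2] zero_le_power[OF d(1), of 3]
      zero_le_power[OF d(1), of 4] zero_le_power[OF d(1), of 5] zero_le_power[OF d(1), of 6]
      zero_le_power[OF d(1), of 7] zero_le_power[OF d(1), of 8] zero_le_power[OF d(1), of 9]
    by linarith
  also have "\<dots> = 0.23 - ?L"
    by (simp add: eval_nat_numeral field_simps)
  finally show ?thesis
    by (simp only: diff_ge_0_iff_ge)
qed

text \<open>Here the bound is at most its value at \<open>a = b = 0\<close> plus 0.011.\<close>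

lemma regret_value_le_small:
  fixes a b c J :: real
  assumes c: "c = 0.611" and ab: "0 \<le> a" "a \<le> b" "b \<le> 0.18" and J: "J \<le> mtay c 1 - mtay c b"
  shows "a * exp (- a / c) + (exp (- a / c) - exp (- b / c)) * qtwo b + J \<le> 0.23"
proof -
  define z where "z = a / c"
  have z: "0 \<le> z" "z \<le> 0.3" and a: "a = c * z"
    using ab by (auto simp: z_def c)
  have q: "0.51 \<le> qtwo b"
  proof (cases "b = 0")
    case False
    then have b: "0 < b" using ab by simp
    have ln18: "- 1.72 \<le> ln (0.18 :: real)"
    proof -
      obtain t where "exp (1.72::real) = (\<Sum>m<8. 1.72 ^ m / fact m) + exp t / fact 8 * 1.72 ^ 8"
        using Maclaurin_exp_le[of "1.72" 8] by blast
      moreover have "0 \<le> exp t / fact 8 * 1.72 ^ 8"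
        by simp
      ultimately have "(\<Sum>m<8. 1.72 ^ m / fact m) \<le> exp (1.72::real)"
        by linarith
      then have "1 / 0.18 \<le> exp (1.72::real)"
        by (simp add: eval_nat_numeral)
      then have "exp (- 1.72) \<le> (0.18::real)"
        by (simp add: exp_minus field_simps)
      then show ?thesis
        by (subst ln_ge_iff) auto
    qed
    have "ln (0.18 / b) \<le> 0.18 / b - 1"
      using b by (intro ln_le_minus_one) auto
    moreover have "ln (0.18 / b) = ln 0.18 - ln b"
      using b by (intro ln_divide_pos) auto
    \<comment> \<open>Multiplied by \<open>b\<close>, this is the tangent at 0.18 to the convex
      function \<open>b * ln b\<close>; the bound 0.51 lies just below
      \<open>qtwo 0.18\<close>.\<close>
    ultimately have "ln 0.18 + 1 - 0.18 / b \<le> ln b"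
      by linarith
    then have "b * (ln 0.18 + 1 - 0.18 / b) \<le> b * ln b"
      using b by (intro mult_left_mono) auto
    moreover have "b * (ln 0.18 + 1 - 0.18 / b) = b * ln 0.18 + b - 0.18"
      using b by (simp add: field_simps)
    moreover have "- (0.18 * 1.72) \<le> b * ln 0.18"
    proof -
      have "b * - ln 0.18 \<le> 0.18 * 1.72"
        using b ab ln18 by (intro mult_mono) auto
      then show ?thesis by simp
    qed
    ultimately show ?thesis
      by (simp add: qtwo_def)
  qed (simp add: qtwo_def)
  have "(a + qtwo b) * exp (- a / c) - qtwo b \<le> 0.011"
  proof -
    have "(a + qtwo b) * exp (- a / c) \<le> (a + qtwo b) * (1 - z + z\<^sup>2 / 2)"
      using exp_minus_le_quadratic[OF z(1)] q ab by (intro mult_left_mono) (auto simp: z_def)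
    also have "\<dots> = qtwo b + c * (z - z\<^sup>2 + z ^ 3 / 2) - qtwo b * (z - z\<^sup>2 / 2)"
      by (simp add: a algebra_simps eval_nat_numeral)
    also have "\<dots> \<le> qtwo b + c * (z - z\<^sup>2 + z ^ 3 / 2) - 0.51 * (z - z\<^sup>2 / 2)"
    proof -
      have "0 \<le> z * (1 - z / 2)"
        using z by simp
      then have "0 \<le> z - z\<^sup>2 / 2"
        by (simp add: power2_eq_square algebra_simps)
      then have "0.51 * (z - z\<^sup>2 / 2) \<le> qtwo b * (z - z\<^sup>2 / 2)"
        using q by (rule mult_right_mono[rotated])
      then show ?thesis by simp
    qed
    finally have "(a + qtwo b) * exp (- a / c) - qtwo b \<le> 0.101 * z - 0.356 * z\<^sup>2 + 0.3055 * z ^ 3"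
      by (simp add: c field_simps)
    moreover have "z ^ 3 \<le> 0.3 * z\<^sup>2"
      using mult_right_mono[OF z(2), of "z\<^sup>2"] by (simp add: eval_nat_numeral)
    \<comment> \<open>The tangent to \<open>z\<^sup>2\<close> at 0.2, close to the maximiser of the
      quadratic left after the cubic term is absorbed.\<close>
    moreover have "0 \<le> (z - 0.2)\<^sup>2"
      by simp
    then have "0.4 * z - 0.04 \<le> z\<^sup>2"
      by (simp add: power2_eq_square algebra_simps)
    ultimately show ?thesis
      using z by simp
  qed
  \<comment> \<open>The claimed bound is the sum of the excess just estimated, this nonpositive term
    and \<open>mtay c 1\<close>.\<close>
  moreover have "qtwo b * (1 - exp (- b / c)) - mtay c b \<le> 0"
    using ab c by (intro taylor_loss_decreasing) auto
  moreover have "mtay c 1 \<le> 0.217"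
    by (simp add: mtay_def c power2_eq_square)
  ultimately show ?thesis
    using J by (simp add: algebra_simps)
qed

text \<open>Both sides vanish at 1, and the derivatives compare by the first two terms of the series
  of \<open>- ln y\<close>.\<close>

lemma qtwo_ge_cubic:
  assumes "0 < b" "b \<le> 1"
  shows "(1 - b)\<^sup>2 / 2 + (1 - b) ^ 3 / 6 \<le> qtwo b"
proof -
  have "qtwo 1 - ((1 - 1)\<^sup>2 / 2 + (1 - 1) ^ 3 / 6) \<le> qtwo b - ((1 - b)\<^sup>2 / 2 + (1 - b) ^ 3 / 6)"
  proof (rule DERIV_nonpos_imp_nonincreasing[where f = "\<lambda>b. qtwo b - ((1 - b)\<^sup>2 / 2 + (1 - b) ^ 3 / 6)"])
    fix y assume y: "b \<le> y" "y \<le> 1"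
    then have y0: "0 < y" using assms by simp
    have "((\<lambda>b. qtwo b - ((1 - b)\<^sup>2 / 2 + (1 - b) ^ 3 / 6)) has_real_derivative
        ln y + ((1 - y) + (1 - y)\<^sup>2 / 2)) (at y)"
      by (rule derivative_eq_intros qtwo_deriv[OF y0] refl | simp)+ (simp add: field_simps eval_nat_numeral)
    moreover have "(1 - y) + (1 - y)\<^sup>2 / 2 \<le> - ln y"
      using sum_power_divide_le_minus_ln[of "1 - y" "{1, 2}"] y y0 by simp
    ultimately show "\<exists>d. ((\<lambda>b. qtwo b - ((1 - b)\<^sup>2 / 2 + (1 - b) ^ 3 / 6)) has_real_derivative d) (at y) \<and> d \<le> 0"
      by (intro exI conjI) (assumption, simp)
  qed (use assms in auto)
  then show ?thesis by (simp add: qtwo_def)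
qed

lemma regret_value_le_large:
  fixes a b c J :: real
  assumes c: "c = 0.611" and ab: "0 \<le> a" "a \<le> b" "0.18 \<le> b" "b \<le> 1"
    and J: "J \<le> exp (- b / c) * jlin b / c"
  shows "a * exp (- a / c) + (exp (- a / c) - exp (- b / c)) * qtwo b + J \<le> 0.23"
proof -
  have c0: "0 < c" and b0: "0 < b" using c ab by auto
  define d where "d = 1 - b"
  have d: "0 \<le> d" "d \<le> 0.82" and b: "b = 1 - d"
    using ab by (auto simp: d_def)
  define p where "p = d\<^sup>2 / 2 + d ^ 3 / 6"
  \<comment> \<open>The part of \<open>jlin b / c\<close> free of \<open>qtwo b\<close>.\<close>
  define W where "W = (d\<^sup>2 / 2 - d ^ 3 / 3) / c"
  define q where "q = qtwo b"
  have pq: "p \<le> q"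
    using qtwo_ge_cubic[of b] ab by (simp add: p_def q_def d_def)
  have p0: "0 \<le> p"
    using d by (simp add: p_def)
  have exp_split: "c * exp (s / c - 1) * exp (- r / c) = c * exp ((s - r) / c - 1)" for r s
    by (simp flip: exp_add add: diff_divide_distrib)
  \<comment> \<open>maximise over \<open>a\<close>\<close>
  have 1: "(a + q) * exp (- a / c) \<le> c * exp (q / c - 1)"
  proof -
    have "(a + q) / c \<le> exp ((a + q) / c - 1)"
      using exp_ge_add_one_self[of "(a + q) / c - 1"] by simp
    then have "(a + q) * exp (- a / c) \<le> c * exp ((a + q) / c - 1) * exp (- a / c)"
      using c0 by (intro mult_right_mono) (auto simp: field_simps)
    then show ?thesis
      by (simp only: exp_split) simp
  qed
  \<comment> \<open>the resulting bound decreases in \<open>q\<close>, so \<open>q\<close> may be replaced by its lower bound \<open>p\<close>\<close>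
  have 2: "exp (q / c - 1) \<le> exp (- b / c) * (1 + b / c)"
  proof -
    \<comment> \<open>Taking logarithms and inserting \<open>q + b = 1 + b * ln b\<close>, the claim
      becomes \<open>1 - c \<le> c * ln (1 + b / c) + b * - ln b\<close>. Both logarithms are
      replaced by rational lower bounds.\<close>
    have "2 * b / (2 * c + b) \<le> ln (1 + b / c)"
    proof -
      have "2 * (b / c) / (2 + b / c) = 2 * b / (2 * c + b)"
        using c0 b0 by (simp add: field_simps)
      then show ?thesis
        using ln_one_plus_ge[of "b / c"] c0 b0 by simp
    qed
    then have A: "c * (2 * b / (2 * c + b)) \<le> c * ln (1 + b / c)"
      using c0 by (intro mult_left_mono) auto
    have "2 * (1 - b) / (1 + b) \<le> - ln b"
    proof -
      have "2 + (1 - b) / b = (1 + b) / b"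
        using b0 by (simp add: field_simps)
      then have "2 * ((1 - b) / b) / (2 + (1 - b) / b) = 2 * (1 - b) / (1 + b)"
        using b0 by simp
      moreover have "1 + (1 - b) / b = 1 / b"
        using b0 by (simp add: field_simps)
      moreover have "2 * ((1 - b) / b) / (2 + (1 - b) / b) \<le> ln (1 + (1 - b) / b)"
        using ab b0 by (intro ln_one_plus_ge) auto
      ultimately have "2 * (1 - b) / (1 + b) \<le> ln (1 / b)"
        by (simp only:)
      then show ?thesis
        using b0 by (simp add: ln_div)
    qed
    then have B: "b * (2 * (1 - b) / (1 + b)) \<le> b * - ln b"
      using b0 by (intro mult_left_mono) auto
    have "1 - c \<le> c * (2 * b / (2 * c + b)) + b * (2 * (1 - b) / (1 + b))"
    proof -
      \<comment> \<open>The factor \<open>b + 0.9855\<close> matches the cubic and quadratic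
        coefficients of the numerator; the linear remainder is positive from 0.18 on.\<close>
      have "0 \<le> 2 * ((b - 0.18) * (1 - b) * (b + 0.9855)) + (0.835862 * b - 0.120578)"
        using ab by simp
      also have "\<dots> = 1.222 * b * (1 + b) + 2 * b * (1 - b) * (1.222 + b) - 0.389 * ((1.222 + b) * (1 + b))"
        by (simp add: field_simps)
      finally have "0.389 * ((1.222 + b) * (1 + b)) \<le> 1.222 * b * (1 + b) + 2 * b * (1 - b) * (1.222 + b)"
        by simp
      then have "0.389 \<le> (1.222 * b * (1 + b) + 2 * b * (1 - b) * (1.222 + b)) / ((1.222 + b) * (1 + b))"
        using b0 by (simp add: pos_le_divide_eq)
      also have "\<dots> = c * (2 * b / (2 * c + b)) + b * (2 * (1 - b) / (1 + b))"
        using b0 by (simp add: c add_divide_distrib)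
      finally show ?thesis by (simp add: c)
    qed
    with A B have "q + b - c \<le> c * ln (1 + b / c)"
      by (simp add: q_def qtwo_def)
    then have "q / c - 1 + b / c \<le> ln (1 + b / c)"
      using c0 by (simp add: field_simps)
    then have "exp (q / c - 1 + b / c) \<le> 1 + b / c"
      using c0 b0 by (subst (asm) ln_ge_iff) (auto simp: add_pos_pos)
    then have "exp (- b / c) * exp (q / c - 1 + b / c) \<le> exp (- b / c) * (1 + b / c)"
      by (intro mult_left_mono) auto
    then show ?thesis
      by (simp flip: exp_add)
  qed
  \<comment> \<open>By convexity the slope at the right end \<open>q\<close> bounds the difference
    quotient on \<open>[p, q]\<close>.\<close>
  have 3: "c * exp (q / c - 1) - c * exp (p / c - 1) \<le> (q - p) * (exp (- b / c) * (1 + b / c))"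
  proof -
    have "1 - (q - p) / c \<le> exp (- (q - p) / c)"
      using exp_ge_add_one_self[of "- (q - p) / c"] by (simp only: minus_divide_left[symmetric] diff_conv_add_uminus)
    then have "c * exp (q / c - 1) * (1 - (q - p) / c) \<le> c * exp (q / c - 1) * exp (- (q - p) / c)"
      by (rule mult_left_mono) (use c0 in simp)
    also have "\<dots> = c * exp (p / c - 1)"
      by (simp only: exp_split) simp
    finally have "c * exp (q / c - 1) * (1 - (q - p) / c) \<le> c * exp (p / c - 1)" .
    moreover have "c * exp (q / c - 1) * (1 - (q - p) / c) = c * exp (q / c - 1) - (q - p) * exp (q / c - 1)"
      using c0 by (simp add: field_simps)
    ultimately have "c * exp (q / c - 1) - c * exp (p / c - 1) \<le> (q - p) * exp (q / c - 1)"
      by linarith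
    also have "\<dots> \<le> (q - p) * (exp (- b / c) * (1 + b / c))"
      using 2 pq by (intro mult_left_mono) auto
    finally show ?thesis .
  qed
  have J': "J \<le> exp (- b / c) * (W - b / c * q)"
  proof -
    have "jlin b / c = W - b / c * q"
      by (simp add: W_def q_def jlin_def d_def diff_divide_distrib)
    then show ?thesis
      using J by (simp only: times_divide_eq_right[symmetric])
  qed
  have poly: "p * (1 + b / c) - W = d\<^sup>2 / 2 + d ^ 3 / 6 - d ^ 4 / (6 * c)"
    using c0 by (simp add: p_def W_def b field_simps eval_nat_numeral)
  \<comment> \<open>\<open>R\<close> and \<open>T\<close> have decimal coefficients rounded in the
    safe direction: 1.6367 exceeds \<open>1 / c\<close>, and \<open>T\<close> rounds down the
    quartic Taylor polynomial of \<open>exp (d / c)\<close>. Nonnegativity of \<open>R\<close>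
    allows multiplying the two lower bounds.\<close>
  define R where "R = d\<^sup>2 / 2 + d ^ 3 / 6 - 1.6367 * d ^ 4 / 6"
  have R: "0 \<le> R" "R \<le> p * (1 + b / c) - W"
  proof -
    have "d ^ 4 * 1 \<le> d ^ 4 * 1.6367" "d ^ 4 / c \<le> d ^ 4 * 1.6367"
      using d by (auto simp: c)
    then show "R \<le> p * (1 + b / c) - W"
      unfolding poly R_def using c0 by (simp add: mult.commute)
    have "d * d \<le> 0.82 * 0.82"
      using d by (intro mult_mono) auto
    then have "0 \<le> d\<^sup>2 * (1 / 2 + d / 6 - 1.6367 * (d * d) / 6)"
      using d by (intro mult_nonneg_nonneg) auto
    also have "\<dots> = R"
      by (simp add: R_def algebra_simps eval_nat_numeral)
    finally show "0 \<le> R" .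
  qed
  define T where "T = 1 + 1.6366 * d + 1.3392 * d\<^sup>2 + 0.7306 * d ^ 3 + 0.2989 * d ^ 4"
  \<comment> \<open>Since \<open>b = 1 - d\<close>, the exponential factors as
    \<open>exp (- 1 / c) * exp (d / c)\<close>.\<close>
  have T: "0.1946 * T \<le> exp (- b / c)"
  proof -
    have "1 + d / c + (d / c)\<^sup>2 / 2 + (d / c) ^ 3 / 6 + (d / c) ^ 4 / 24 \<le> exp (d / c)"
      using d c0 by (intro exp_ge_quartic) auto
    moreover have "T \<le> 1 + d / c + (d / c)\<^sup>2 / 2 + (d / c) ^ 3 / 6 + (d / c) ^ 4 / 24"
      unfolding T_def using d zero_le_power[OF d(1), of 2] zero_le_power[OF d(1), of 3] zero_le_power[OF d(1), of 4]
      by (intro add_mono) (auto simp: c power_divide power_mult_distrib)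
    ultimately have "0.1946 * T \<le> exp (- (1000 / 611)) * exp (d / c)"
      using exp_last_threshold_bound d by (intro mult_mono) (auto simp: T_def)
    also have "\<dots> = exp (- b / c)"
      by (simp add: b c field_simps flip: exp_add)
    finally show ?thesis .
  qed
  have main: "c * exp (p / c - 1) - exp (- b / c) * (p * (1 + b / c) - W) \<le> 0.23"
  proof -
    have "0.1946 * T * R \<le> exp (- b / c) * (p * (1 + b / c) - W)"
      using T R d by (intro mult_mono) auto
    moreover have "c * exp (p / c - 1) \<le> 0.611 * 0.36788 + 0.36788 * p * (1 + 1.6367 * p / 2 + 0.21 * (1.6367 * p)\<^sup>2)"
    proof -
      have "p \<le> 0.82\<^sup>2 / 2 + 0.82 ^ 3 / 6"
        unfolding p_def using d by (intro add_mono divide_right_mono power_mono) auto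
      then have pc: "0 \<le> p / c" "p / c \<le> 0.71"
        using p0 by (auto simp: c power2_eq_square power3_eq_cube)
      have "c * exp (p / c - 1) = exp (- 1) * (c * exp (p / c))"
        by (simp flip: exp_add)
      also have "\<dots> \<le> 0.36788 * (c * (1 + p / c + (p / c)\<^sup>2 / 2 + 0.21 * (p / c) ^ 3))"
        using exp_one_bound exp_le_cubic[OF pc] c0 by (intro mult_mono) auto
      also have "\<dots> = 0.611 * 0.36788 + 0.36788 * p * (1 + p / c / 2 + 0.21 * (p / c)\<^sup>2)"
        by (simp add: c field_simps eval_nat_numeral)
      also have "\<dots> \<le> 0.611 * 0.36788 + 0.36788 * p * (1 + 1.6367 * p / 2 + 0.21 * (1.6367 * p)\<^sup>2)"
      proof -
        have "p / c \<le> 1.6367 * p"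
          using p0 by (simp add: c)
        then show ?thesis
          using p0 pc by (intro add_mono mult_left_mono power_mono divide_right_mono order.refl) auto
      qed
      finally show ?thesis .
    qed
    moreover have "0.611 * 0.36788 + 0.36788 * p * (1 + 1.6367 * p / 2 + 0.21 * (1.6367 * p)\<^sup>2) - 0.1946 * T * R \<le> 0.23"
      using regret_polynomial_le[OF d] by (simp only: p_def T_def R_def)
    ultimately show ?thesis by linarith
  qed
  have "a * exp (- a / c) + (exp (- a / c) - exp (- b / c)) * q + J =
      (a + q) * exp (- a / c) - exp (- b / c) * q + J"
    by (simp add: algebra_simps)
  also have "\<dots> \<le> c * exp (q / c - 1) - exp (- b / c) * q + exp (- b / c) * (W - b / c * q)"
    using 1 J' by linarith
  also have "\<dots> = c * exp (q / c - 1) - exp (- b / c) * (q * (1 + b / c) - W)"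
    by (simp add: algebra_simps)
  also have "\<dots> \<le> c * exp (p / c - 1) - exp (- b / c) * (p * (1 + b / c) - W)"
    using 3 by (simp add: algebra_simps diff_divide_distrib)
  also note main
  finally show ?thesis
    by (simp only: q_def)
qed

section \<open>Assembling the bound for a single instance\<close>

lemma nn_integral_no_pick_le:
  fixes f :: "real \<Rightarrow> real"
  assumes "0 \<le> a" "a \<le> 1" "0 \<le> w" and f[measurable]: "f \<in> borel_measurable borel"
    and "\<And>y. y \<in> {0<..<1} \<Longrightarrow> a < y \<Longrightarrow> f y \<le> w"
  shows "(\<integral>\<^sup>+y. ennreal w * indicator {y. w < f y} y \<partial>unif) \<le> ennreal (w * a)"
proof -
  have "(\<integral>\<^sup>+y. ennreal w * indicator {y. w < f y} y \<partial>unif) \<le> ennreal (w * a - w * 0)"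
  proof (rule nn_integral_unif_le[where \<phi> = "\<lambda>_. w" and F = "\<lambda>y. w * y"])
    show "ennreal w * indicator {y. w < f y} y = 0" if "y \<in> {0<..<1} - {0..a}" for y
      using assms(5)[of y] that by (auto simp: indicator_def)
    show "ennreal w * indicator {y. w < f y} y \<le> ennreal w" for y
      by (auto simp: indicator_def)
  qed (use assms in \<open>auto intro!: derivative_eq_intros continuous_intros\<close>)
  then show ?thesis by simp
qed

text \<open>Three cases: for \<open>x 1 \<le> 0.23\<close> the regret is at most \<open>x 1\<close>;
  if \<open>v\<close> lies below all thresholds, only the loss from picking nothing remains;
  otherwise both crossing times lie in the unit interval and the estimates in \<open>a\<close> and
  \<open>b\<close> apply.\<close>

lemma instance_regret_exp_le:
  fixes x :: "nat \<Rightarrow> real" and c :: real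
  assumes n: "1 \<le> n" and x: "antimono_on {1..n} x" and x01: "\<And>i. i \<in> {1..n} \<Longrightarrow> 0 \<le> x i \<and> x i \<le> 1"
    and c: "c = 0.611"
  shows "x 1 - (\<integral>t. best_only_pricing (\<lambda>t. exp (- t / c)) n x t \<partial>arrival_times n) \<le> 0.23"
    (is "?R \<le> _")
proof -
  define f where "f t = exp (- t / c)" for t
  have c0: "0 < c" using c by simp
  have f_meas: "f \<in> borel_measurable borel"
    unfolding f_def by measurable
  have f_mono: "antimono_on {0..1} f"
    using c0 by (auto simp: monotone_on_def f_def divide_right_mono)
  \<comment> \<open>A lone item gets the fictitious second value 0.\<close>
  define v where "v = (if 2 \<le> n then x 2 else 0)"
  have v: "0 \<le> v" "v \<le> x 1" "2 \<le> n \<Longrightarrow> v = x 2"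
    using x01[of 1] x01[of 2] monotone_onD[OF x, of 1 2] n by (auto simp: v_def)
  have x1: "0 \<le> x 1" "x 1 \<le> 1"
    using x01[of 1] n by auto
  have E_nonneg: "0 \<le> (\<integral>t. best_only_pricing f n x t \<partial>arrival_times n)"
    using best_only_pricing_bounds[of n x 1 f] x01 by (intro integral_nonneg_AE) auto
  have R_eq: "?R = x 1 - (\<integral>t. best_only_pricing f n x t \<partial>arrival_times n)"
    unfolding f_def[abs_def] ..
  have main: "ennreal ?R \<le>
    (\<integral>\<^sup>+y. ennreal (x 1) * indicator {y. x 1 < f y} y \<partial>unif) +
    (\<integral>\<^sup>+y. ennreal (x 1 - v) * indicator {y. f y \<le> v} y * ennreal (- ln y) \<partial>unif) +
    (\<integral>\<^sup>+y. ennreal (v - f y) * ennreal (2 * (y - 1 - ln y)) \<partial>unif)"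
    unfolding R_eq using x01 by (intro instance_regret_le n x f_meas f_mono v) auto
  show ?thesis
  proof (cases "x 1 \<le> 0.23")
    case True
    then show ?thesis
      using E_nonneg unfolding R_eq by linarith
  next
    case False
    then have x1_pos: "0 < x 1" by simp
    \<comment> \<open>The time at which the threshold equals \<open>x 1\<close>. It is at most 1
      because \<open>f 1 \<le> 0.23 < x 1\<close>.\<close>
    define a where "a = - c * ln (x 1)"
    have x1_eq: "x 1 = exp (- a / c)"
      using x1_pos c0 by (simp add: a_def)
    have "f 1 \<le> 0.23"
    proof -
      have "1 + 1.6 + 1.6\<^sup>2 / 2 + 1.6 ^ 3 / 6 + 1.6 ^ 4 / 24 \<le> exp (1.6::real)"
        by (rule exp_ge_quartic) simp
      also have "exp (1.6::real) \<le> exp (1 / c)"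
        by (simp add: c)
      finally have "1 / 0.23 \<le> exp (1 / c)"
        by (simp add: eval_nat_numeral)
      then show ?thesis
        by (simp add: f_def exp_minus field_simps)
    qed
    then have "f 1 < x 1"
      using False by linarith
    then have "exp (- 1 / c) < exp (- a / c)"
      by (simp only: f_def x1_eq)
    then have "- 1 / c < - a / c"
      by (simp only: exp_less_cancel_iff)
    then have "a \<le> 1"
      using c0 by (simp add: field_simps)
    moreover have "0 \<le> a"
      using x1 x1_pos c0 by (auto simp: a_def mult_nonneg_nonpos)
    ultimately have a: "0 \<le> a" "a \<le> 1"
      by auto
    have f_le: "f y \<le> x 1" if "a < y" for y
      unfolding x1_eq f_def using that c0 by (simp add: divide_right_mono)
    have T1: "(\<integral>\<^sup>+y. ennreal (x 1) * indicator {y. x 1 < f y} y \<partial>unif) \<le> ennreal (x 1 * a)"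
      using a x1 f_meas f_le by (intro nn_integral_no_pick_le) auto
    show ?thesis
    proof (cases "f 1 \<le> v")
      case False
      have f_gt: "v < f y" if "y \<in> {0..1}" for y
        using monotone_onD[OF f_mono, of y 1] that False by auto
      have "(\<integral>\<^sup>+y. ennreal (x 1 - v) * indicator {y. f y \<le> v} y * ennreal (- ln y) \<partial>unif) \<le> ennreal ((x 1 - v) * qtwo 1)"
        using v f_meas f_gt by (intro nn_integral_first_loss_le) auto
      moreover have "(\<integral>\<^sup>+y. ennreal (v - f y) * ennreal (2 * (y - 1 - ln y)) \<partial>unif) = 0"
      proof -
        have "AE y in unif. ennreal (v - f y) * ennreal (2 * (y - 1 - ln y)) = 0"
          using f_gt by (intro eventually_mono[OF AE_unif]) (auto simp: ennreal_neg less_imp_le)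
        then show ?thesis
          using f_meas by (subst nn_integral_0_iff_AE) auto
      qed
      ultimately have "ennreal ?R \<le> ennreal (x 1 * a)"
        using main T1 by (simp add: qtwo_def)
      then have "?R \<le> x 1 * a"
        using a x1 by (simp add: ennreal_le_iff)
      \<comment> \<open>The maximum of \<open>a * exp (- a / c)\<close>, attained at
        \<open>a = c\<close>.\<close>
      also have "x 1 * a \<le> c * exp (- 1)"
      proof -
        have "a / c \<le> exp (a / c - 1)"
          using exp_ge_add_one_self[of "a / c - 1"] by simp
        then have "exp (- a / c) * (a / c) \<le> exp (- a / c) * exp (a / c - 1)"
          by (intro mult_left_mono) auto
        then have "exp (- a / c) * (a / c) \<le> exp (- 1)"
          by (simp flip: exp_add)
        then show ?thesis
          unfolding x1_eq using c0 by (simp add: field_simps)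
      qed
      also have "\<dots> \<le> 0.23"
        using exp_one_bound by (simp add: c)
      finally show ?thesis .
    next
      case True
      then have v_pos: "0 < v"
        using exp_gt_zero[of "- 1 / c"] unfolding f_def by linarith
      define b where "b = - c * ln v"
      have v_eq: "v = exp (- b / c)"
        using v_pos c0 by (simp add: b_def)
      have ab: "a \<le> b" "b \<le> 1"
      proof -
        have "exp (- b / c) \<le> exp (- a / c)" "exp (- 1 / c) \<le> exp (- b / c)"
          using v(2) True by (simp_all only: f_def v_eq x1_eq)
        then have "- b / c \<le> - a / c" "- 1 / c \<le> - b / c"
          by (simp_all only: exp_le_cancel_iff)
        then show "a \<le> b" "b \<le> 1"
          using c0 by (simp_all add: field_simps)
      qed
      have T2: "(\<integral>\<^sup>+y. ennreal (x 1 - v) * indicator {y. f y \<le> v} y * ennreal (- ln y) \<partial>unif)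
          \<le> ennreal ((x 1 - v) * qtwo b)"
        using a ab v f_meas c0
        by (intro nn_integral_first_loss_le) (auto simp: f_def v_eq divide_strict_right_mono)
      \<comment> \<open>The two majorants of the later loss are switched at 0.18, where the
        estimates for small and large \<open>b\<close> meet.\<close>
      define J where "J = (if b \<le> 0.18 then mtay c 1 - mtay c b else exp (- b / c) * jlin b / c)"
      have T3: "(\<integral>\<^sup>+y. ennreal (v - f y) * ennreal (2 * (y - 1 - ln y)) \<partial>unif) \<le> ennreal J"
        using nn_integral_later_loss_exp_le[of b c] a ab c0 by (auto simp: f_def v_eq J_def)
      have J_nonneg: "0 \<le> J"
        using a ab c0 mtay_mono[of b c] jlin_nonneg[of b] by (auto simp: J_def)
      have bound: "x 1 * a + (x 1 - v) * qtwo b + J \<le> 0.23"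
      proof -
        have "a * exp (- a / c) + (exp (- a / c) - exp (- b / c)) * qtwo b + J \<le> 0.23"
        proof (cases "b \<le> 0.18")
          case True
          then show ?thesis
            using a ab by (intro regret_value_le_small c) (auto simp: J_def)
        next
          case False
          then show ?thesis
            using a ab by (intro regret_value_le_large c) (auto simp: J_def)
        qed
        then show ?thesis
          by (simp only: x1_eq v_eq mult.commute)
      qed
      have "0 \<le> qtwo b"
      proof (cases "b = 0")
        case False
        have "0 \<le> (1 - b)\<^sup>2 / 2 + (1 - b) ^ 3 / 6"
          using ab by simp
        also have "\<dots> \<le> qtwo b"
          using False a ab by (intro qtwo_ge_cubic) auto
        finally show ?thesis .
      qed (simp add: qtwo_def)
      have "ennreal ?R \<le> ennreal (x 1 * a) + ennreal ((x 1 - v) * qtwo b) + ennreal J"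
        using main T1 T2 T3 by (meson add_mono order_trans)
      also have "\<dots> = ennreal (x 1 * a + (x 1 - v) * qtwo b + J)"
        using a x1 v \<open>0 \<le> qtwo b\<close> J_nonneg by (simp add: ennreal_plus)
      also have "\<dots> \<le> ennreal 0.23"
        using bound by (rule ennreal_leI)
      finally show ?thesis
        by (subst (asm) ennreal_le_iff) auto
    qed
  qed
qed

theorem theorem4p1:
  "regret (best_only_pricing (\<lambda>t. exp (- t / 0.611))) \<le> ereal 0.23"
  unfolding regret_def
proof (rule SUP_least, clarify)
  fix n :: nat and x :: "nat \<Rightarrow> real"
  assume "(n, x) \<in> secretary_instances"
  then have "x 1 - (\<integral>t. best_only_pricing (\<lambda>t. exp (- t / 0.611)) n x t \<partial>arrival_times n) \<le> 0.23"
    by (intro instance_regret_exp_le[OF _ _ _ refl]) (auto simp: secretary_instances_def)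
  then show "ereal (x 1 - (\<integral>t. best_only_pricing (\<lambda>t. exp (- t / 0.611)) n x t \<partial>arrival_times n)) \<le> ereal 0.23"
    by simp
qed

end
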